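(* Let $K$ be a compact metrizable group and let $\Gamma$ be a finitely generated abelian group of continuous automorphisms of $K$. Suppose that $\Gamma$ is ergodic on $K$ and that $Z(\Gamma)$ has DCC on $K$. Then there exists $\alpha\in\Gamma$ such that $\alpha$ is ergodic on $K$. Furthermore, if $\Gamma$ is generated by $\alpha_1,\dots,\alpha_n$, then there exist positive integers $i_1,\dots,i_n$ such that $\alpha_1^{i_1}\cdots\alpha_n^{i_n}$ is ergodic on $K$.
   Context: $\mathrm{Aut}(K)$ is the group of all continuous automorphisms of the compact group $K$, and $\omega_K$ is the normalized Haar measure of $K$. A group $\Gamma$ of automorphisms is ergodic on $K$ if every $\Gamma$-invariant Borel set $A\subset K$ satisfies $\omega_K(A)\in\{0,1\}$; an automorphism $\alpha$ is ergodic on $K$ if $\{\alpha^n\mid n\in\mathbb{Z}\}$ is ergodic on $K$. $Z(\Gamma)=\{\alpha\in\mathrm{Aut}(K)\mid \alpha\beta=\beta\alpha\text{ for all }\beta\in\Gamma\}$. A group $H$ acting on $K$ by automorphisms has DCC on $K$ if for every decreasing sequence $(K_i)_{i\ge1}$ of $H$-invariant closed subgroups of $K$ there is $n\ge1$ with $K_n=K_{n+i}$ for all $i\ge 0$. *)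

theory Defs
  imports
    "HOL-Analysis.Analysis"
    "HOL-Algebra.Bij"
    "HOL-Algebra.Coset"
    "HOL-Algebra.FiniteProduct"
    "HOL-Algebra.Generated_Groups"
begin

definition topological_group :: "('a, 'b) monoid_scheme \<Rightarrow> 'a topology \<Rightarrow> bool" where
  "topological_group K T \<longleftrightarrow>
     group K \<and> topspace T = carrier K \<and>
     continuous_map (prod_topology T T) T (\<lambda>(x, y). x \<otimes>\<^bsub>K\<^esub> y) \<and>
     continuous_map T T (\<lambda>x. inv\<^bsub>K\<^esub> x)"

definition compact_metrizable_group :: "('a, 'b) monoid_scheme \<Rightarrow> 'a topology \<Rightarrow> bool" where
  "compact_metrizable_group K T \<longleftrightarrow>
     topological_group K T \<and> compact_space T \<and> metrizable_space T"

definition borel_of :: "'a topology \<Rightarrow> 'a measure" where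
  "borel_of T = sigma (topspace T) {U. openin T U}"

(* Regularity is not demanded: every finite Borel measure on a compact metrizable space is
   regular.  Right invariance follows from left invariance because the group is compact. *)
definition normalized_haar_measure ::
    "('a, 'b) monoid_scheme \<Rightarrow> 'a topology \<Rightarrow> 'a measure \<Rightarrow> bool" where
  "normalized_haar_measure K T \<omega> \<longleftrightarrow>
     sets \<omega> = sets (borel_of T) \<and>
     emeasure \<omega> (carrier K) = 1 \<and>
     (\<forall>g \<in> carrier K. \<forall>A \<in> sets \<omega>. emeasure \<omega> (g <#\<^bsub>K\<^esub> A) = emeasure \<omega> A)"

(* As in AutoGroup, automorphisms are extensional functions on the carrier, so that equality
   in this group is equality of functions on K.  Continuity of the inverse is automatic for
   compact Hausdorff K; see group_Aut below. *)
definition Aut :: "('a, 'b) monoid_scheme \<Rightarrow> 'a topology \<Rightarrow> ('a \<Rightarrow> 'a) monoid" where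
  "Aut K T = AutoGroup K \<lparr>carrier := {f \<in> auto K. continuous_map T T f}\<rparr>"

definition centralizer :: "('a, 'b) monoid_scheme \<Rightarrow> 'a set \<Rightarrow> 'a set" where
  "centralizer G H = {a \<in> carrier G. \<forall>b \<in> H. a \<otimes>\<^bsub>G\<^esub> b = b \<otimes>\<^bsub>G\<^esub> a}"

definition invariant_under :: "('a \<Rightarrow> 'a) set \<Rightarrow> 'a set \<Rightarrow> bool" where
  "invariant_under H A \<longleftrightarrow> (\<forall>\<beta> \<in> H. \<beta> ` A = A)"

definition ergodic :: "'a topology \<Rightarrow> 'a measure \<Rightarrow> ('a \<Rightarrow> 'a) set \<Rightarrow> bool" where
  "ergodic T \<omega> H \<longleftrightarrow>
     (\<forall>A \<in> sets (borel_of T). invariant_under H A \<longrightarrow> measure \<omega> A \<in> {0, 1})"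

definition ergodic_automorphism ::
    "('a, 'b) monoid_scheme \<Rightarrow> 'a topology \<Rightarrow> 'a measure \<Rightarrow> ('a \<Rightarrow> 'a) \<Rightarrow> bool" where
  "ergodic_automorphism K T \<omega> \<alpha> \<longleftrightarrow>
     ergodic T \<omega> (range (\<lambda>n :: int. \<alpha> [^]\<^bsub>Aut K T\<^esub> n))"

definition DCC :: "('a, 'b) monoid_scheme \<Rightarrow> 'a topology \<Rightarrow> ('a \<Rightarrow> 'a) set \<Rightarrow> bool" where
  "DCC K T H \<longleftrightarrow>
     (\<forall>C :: nat \<Rightarrow> 'a set.
        (\<forall>i. subgroup (C i) K \<and> closedin T (C i) \<and> invariant_under H (C i)) \<and> decseq C \<longrightarrow>
        (\<exists>n. \<forall>i. C n = C (n + i)))"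

definition fin_gen_subgroup :: "('a, 'b) monoid_scheme \<Rightarrow> 'a set \<Rightarrow> bool" where
  "fin_gen_subgroup G H \<longleftrightarrow>
     subgroup H G \<and> (\<exists>S. finite S \<and> S \<subseteq> H \<and> generate G S = H)"

lemma group_Aut:
  assumes "compact_metrizable_group K T"
  shows "group (Aut K T)"
proof -
  have K: "group K" and top: "topspace T = carrier K" and comp: "compact_space T"
    and haus: "Hausdorff_space T"
    using assms metrizable_imp_Hausdorff_space
    by (auto simp: compact_metrizable_group_def topological_group_def)
  let ?B = "BijGroup (carrier K)"
  let ?C = "{f \<in> auto K. continuous_map T T f}"
  interpret A: subgroup "auto K" ?B
    by (rule group.subgroup_auto[OF K])
  have auto_Bij: "f \<in> Bij (carrier K)" if "f \<in> auto K" for f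
    using that by (simp add: auto_def)
  have "subgroup ?C ?B"
  proof (rule subgroup.intro)
    show "?C \<subseteq> carrier ?B"
      using A.subset by auto
  next
    fix x y assume x: "x \<in> ?C" and y: "y \<in> ?C"
    have "continuous_map T T (x \<circ> y)"
      using x y continuous_map_compose by blast
    then have "continuous_map T T (compose (carrier K) x y)"
      by (rule continuous_map_eq) (simp add: top compose_def)
    then show "x \<otimes>\<^bsub>?B\<^esub> y \<in> ?C"
      using x y A.m_closed[of x y] auto_Bij by (simp add: BijGroup_def)
  next
    have "continuous_map T T (\<lambda>x \<in> carrier K. x)"
      by (rule continuous_map_eq[OF continuous_map_id]) (simp add: top)
    then show "\<one>\<^bsub>?B\<^esub> \<in> ?C"
      using A.one_closed by (simp add: BijGroup_def)
  next
    fix x assume x: "x \<in> ?C"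
    then have bij: "bij_betw x (carrier K) (carrier K)"
      using auto_Bij by (auto simp: Bij_def)
    have "homeomorphic_map T T x"
      using x bij comp haus continuous_imp_homeomorphic_map[of T T x]
      by (simp add: top bij_betw_def)
    then obtain g where g: "homeomorphic_maps T T x g"
      using homeomorphic_map_maps by blast
    then have cg: "continuous_map T T g" and xg: "\<And>y. y \<in> carrier K \<Longrightarrow> x (g y) = y"
      by (auto simp: homeomorphic_maps_def top)
    have "g y = (\<lambda>y \<in> carrier K. inv_into (carrier K) x y) y" if "y \<in> topspace T" for y
    proof -
      have "g y \<in> carrier K"
        using cg that continuous_map_image_subset_topspace top by blast
      then have "inv_into (carrier K) x (x (g y)) = g y"
        using bij by (simp add: bij_betw_def)
      then show ?thesis
        using that xg by (simp add: top)
    qed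
    then have "continuous_map T T (\<lambda>y \<in> carrier K. inv_into (carrier K) x y)"
      using cg continuous_map_eq by blast
    then show "inv\<^bsub>?B\<^esub> x \<in> ?C"
      using x A.m_inv_closed[of x] auto_Bij inv_BijGroup[of x "carrier K"] by simp
  qed
  then show ?thesis
    using subgroup.subgroup_is_group[OF _ group_BijGroup]
    by (fastforce simp: Aut_def AutoGroup_def)
qed

end

(* For a closed normal subgroup R, say that an automorphism f is equicontinuous mod R if the
   identity of K/R has arbitrarily small f-invariant neighbourhoods.  Then f is nonergodic iff it
   is equicontinuous modulo some proper R: small invariant open sets have measure strictly between
   0 and 1, and conversely an invariant Borel set A of such a measure yields the invariant
   continuous pseudonorm x -> measure of (A symmetric difference xA), whose conjugates define an
   invariant metric on a nontrivial quotient.  So no representation theory is needed, and the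
   subgroup R obtained is invariant under everything that commutes with f.  The theorem follows by
   merging two generators a, b into some a b^i at a time: if each a b^i had a proper quotient on
   which it is equicontinuous, the descending chain condition would produce a single proper quotient
   on which a b^i and a b^j with distinct i and j, hence a and b, are equicontinuous. *)

theory Submission
  imports Defs "HOL-Algebra.SndIsomorphismGrp"
begin

section \<open>Compact metrizable groups\<close>

(* The multiset notation makes the left coset notation ambiguous. *)
no_notation subset_mset (infix \<open><#\<close> 50)

text \<open>The quotients \<open>K / L i\<close> attached to different products \<open>a b^i\<close>
  are unrelated, so the chain condition says nothing about the \<open>L i\<close> directly; it has
  to act on auxiliary subgroups \<open>P\<close> large enough that \<open>P L i = K\<close> for
  infinitely many \<open>i\<close>. Two exponents \<open>i < j\<close> suffice because
  \<open>(a b^i)^-1 (a b^j) = b^(j-i)\<close>, and equicontinuity passes from a positive power to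
  its root. The other generators cannot be forgotten while two are merged: ergodicity of the group
  only excludes a proper quotient on which all generators are equicontinuous at once. This joint
  property of a set of automorphisms is what the induction preserves. Since the chain condition
  concerns subgroups invariant under the whole centralizer, every quotient constructed must be as
  well; for this reason the pseudonorms of all \<open>f\<close>-invariant sets are used together,
  not just that of one witness of nonergodicity. Uniqueness of Haar measure enters twice:
  automorphisms preserve \<omega>, and a set invariant under all translations up to null sets has
  measure 0 or 1, which makes the quotient nontrivial.\<close>

lemma second_countable_compact_metrizable:
  assumes "compact_space T" "metrizable_space T"
  shows "second_countable T"
proof -
  obtain M d where "Metric_space M d" and T: "T = Metric_space.mtopology M d"
    using assms(2) by (auto simp: metrizable_space_def)
  interpret Metric_space M d by fact
  have "mtotally_bounded M"
    using assms(1) compactin_imp_mtotally_bounded by (simp add: T compact_space_def)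
  then have "\<exists>F. finite F \<and> F \<subseteq> M \<and> M \<subseteq> (\<Union>x\<in>F. mball x (inverse (Suc n)))" for n
    unfolding mtotally_bounded_def by simp
  then obtain F where F: "\<And>n. finite (F n)" "\<And>n. F n \<subseteq> M"
    "\<And>n. M \<subseteq> (\<Union>x\<in>F n. mball x (inverse (Suc n)))"
    by metis
  let ?B = "\<Union>n. (\<lambda>x. mball x (inverse (Suc n))) ` F n"
  show ?thesis
    unfolding second_countable_def
  proof (intro exI[of _ ?B] conjI ballI allI impI)
    show "countable ?B"
      by (intro countable_UN countable_image countable_finite F(1) countableI_type)
  next
    fix V assume "V \<in> ?B"
    then show "openin T V" by (auto simp: T)
  next
    fix U x assume "openin T U \<and> x \<in> U"
    then obtain r where r: "r > 0" "mball x r \<subseteq> U" and xM: "x \<in> M"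
      unfolding T openin_mtopology by blast
    obtain n where n: "inverse (real (Suc n)) < r / 2"
      using reals_Archimedean[of "r / 2"] r(1) by auto
    obtain y where y: "y \<in> F n" "x \<in> mball y (inverse (Suc n))"
      using F(3)[of n] xM by blast
    have "mball y (inverse (Suc n)) \<subseteq> mball x r"
    proof
      fix z assume z: "z \<in> mball y (inverse (Suc n))"
      have "d x z \<le> d y x + d y z"
        using triangle[of x y z] y z xM by (simp add: commute)
      also have "\<dots> < r" using y(2) z n by simp
      finally show "z \<in> mball x r" using z xM by simp
    qed
    then show "\<exists>V\<in>?B. x \<in> V \<and> V \<subseteq> U"
      using y r(2) by blast
  qed
qed

section \<open>Borel sets of a topology and of a product of two topologies\<close>

lemma space_borel_of [simp]: "space (borel_of T) = topspace T"
  by (simp add: borel_of_def space_measure_of_conv)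

lemma sets_borel_of: "sets (borel_of T) = sigma_sets (topspace T) {U. openin T U}"
  unfolding borel_of_def by (subst sets_measure_of) (auto dest: openin_subset)

lemma borel_of_openin [intro]: "openin T U \<Longrightarrow> U \<in> sets (borel_of T)"
  by (simp add: sets_borel_of sigma_sets.Basic)

lemma measurable_borel_of_continuous_map:
  assumes "continuous_map S T f"
  shows "f \<in> measurable (borel_of S) (borel_of T)"
  unfolding borel_of_def[of T]
proof (rule measurable_measure_of)
  show "{U. openin T U} \<subseteq> Pow (topspace T)"
    by (auto dest: openin_subset)
  show "f \<in> space (borel_of S) \<rightarrow> topspace T"
    using assms by (auto simp: continuous_map_def)
  fix U assume "U \<in> {U. openin T U}"
  then have "openin S {x \<in> topspace S. f x \<in> U}"
    using assms by (auto simp: continuous_map_def)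
  moreover have "f -` U \<inter> space (borel_of S) = {x \<in> topspace S. f x \<in> U}" by auto
  ultimately show "f -` U \<inter> space (borel_of S) \<in> sets (borel_of S)"
    by auto
qed

text \<open>With countable bases an open set is a countable union of open rectangles. This makes the
  group operation measurable for the product sigma-algebra, which Fubini requires.\<close>

lemma sets_borel_of_prod_topology:
  assumes X: "second_countable X" and Y: "second_countable Y" and U: "openin (prod_topology X Y) U"
  shows "U \<in> sets (borel_of X \<Otimes>\<^sub>M borel_of Y)"
proof -
  obtain \<B> where \<B>: "countable \<B>" "\<And>V. V \<in> \<B> \<Longrightarrow> openin X V"
    "\<And>W x. openin X W \<Longrightarrow> x \<in> W \<Longrightarrow> \<exists>V\<in>\<B>. x \<in> V \<and> V \<subseteq> W"
    using X unfolding second_countable_def by metis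
  obtain \<C> where \<C>: "countable \<C>" "\<And>V. V \<in> \<C> \<Longrightarrow> openin Y V"
    "\<And>W x. openin Y W \<Longrightarrow> x \<in> W \<Longrightarrow> \<exists>V\<in>\<C>. x \<in> V \<and> V \<subseteq> W"
    using Y unfolding second_countable_def by metis
  let ?R = "{(V, W). V \<in> \<B> \<and> W \<in> \<C> \<and> V \<times> W \<subseteq> U}"
  have U_eq: "U = (\<Union>(V, W)\<in>?R. V \<times> W)"
  proof
    show "U \<subseteq> (\<Union>(V, W)\<in>?R. V \<times> W)"
    proof clarify
      fix x y assume "(x, y) \<in> U"
      then obtain V W where VW: "openin X V" "openin Y W" "x \<in> V" "y \<in> W" "V \<times> W \<subseteq> U"
        using U unfolding openin_prod_topology_alt by metis
      obtain V' W' where "V' \<in> \<B>" "x \<in> V'" "V' \<subseteq> V" "W' \<in> \<C>" "y \<in> W'" "W' \<subseteq> W"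
        using \<B>(3)[OF VW(1,3)] \<C>(3)[OF VW(2,4)] by metis
      then show "(x, y) \<in> (\<Union>(V, W)\<in>?R. V \<times> W)"
        using VW(5) by blast
    qed
  qed auto
  show ?thesis
  proof (subst U_eq, rule sets.countable_UN'')
    show "countable ?R"
      by (rule countable_subset[of _ "\<B> \<times> \<C>"]) (use \<B>(1) \<C>(1) in auto)
    show "(case p of (V, W) \<Rightarrow> V \<times> W) \<in> sets (borel_of X \<Otimes>\<^sub>M borel_of Y)" if "p \<in> ?R" for p
      using that \<B>(2) \<C>(2) by auto
  qed
qed

lemma measurable_pair_borel_of_continuous_map:
  assumes "second_countable X" "second_countable Y" and f: "continuous_map (prod_topology X Y) T f"
  shows "f \<in> measurable (borel_of X \<Otimes>\<^sub>M borel_of Y) (borel_of T)"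
  unfolding borel_of_def[of T]
proof (rule measurable_measure_of)
  show "{U. openin T U} \<subseteq> Pow (topspace T)"
    by (auto dest: openin_subset)
  show "f \<in> space (borel_of X \<Otimes>\<^sub>M borel_of Y) \<rightarrow> topspace T"
    using f by (auto simp: continuous_map_def space_pair_measure)
  fix U assume "U \<in> {U. openin T U}"
  then have "openin (prod_topology X Y) {x \<in> topspace (prod_topology X Y). f x \<in> U}"
    using f by (auto simp: continuous_map_def)
  moreover have "f -` U \<inter> space (borel_of X \<Otimes>\<^sub>M borel_of Y)
      = {x \<in> topspace (prod_topology X Y). f x \<in> U}"
    by (auto simp: space_pair_measure)
  ultimately show "f -` U \<inter> space (borel_of X \<Otimes>\<^sub>M borel_of Y) \<in> sets (borel_of X \<Otimes>\<^sub>M borel_of Y)"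
    using sets_borel_of_prod_topology[OF assms(1,2)] by simp
qed

locale compact_group = group K for K (structure) +
  fixes T :: "'a topology"
  assumes compact_metrizable: "compact_metrizable_group K T"
begin

lemma topspace [simp]: "topspace T = carrier K"
  and compact: "compact_space T"
  and metrizable: "metrizable_space T"
  and continuous_mult: "continuous_map (prod_topology T T) T (\<lambda>(x, y). x \<otimes> y)"
  and continuous_inv: "continuous_map T T (\<lambda>x. inv x)"
  using compact_metrizable by (auto simp: compact_metrizable_group_def topological_group_def)

lemma Hausdorff: "Hausdorff_space T"
  by (simp add: metrizable metrizable_imp_Hausdorff_space)

lemma second_countable: "second_countable T"
  by (simp add: second_countable_compact_metrizable compact metrizable)

lemma continuous_map_mult:
  assumes "continuous_map X T f" "continuous_map X T g"
  shows "continuous_map X T (\<lambda>x. f x \<otimes> g x)"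
  using continuous_map_compose[OF continuous_map_pairedI[OF assms] continuous_mult]
  by (simp add: o_def)

lemma continuous_map_inv:
  assumes "continuous_map X T f"
  shows "continuous_map X T (\<lambda>x. inv (f x))"
  using continuous_map_compose[OF assms continuous_inv] by (simp add: o_def)

section \<open>Translates and products of subsets\<close>

lemma l_coset_eq_preimage:
  assumes "g \<in> carrier K" "A \<subseteq> carrier K"
  shows "g <# A = {x \<in> carrier K. inv g \<otimes> x \<in> A}"
proof safe
  fix x assume "x \<in> g <# A"
  then obtain a where a: "a \<in> A" "x = g \<otimes> a" by (auto simp: l_coset_def)
  then show "x \<in> carrier K" "inv g \<otimes> x \<in> A"
    using assms by (auto simp: m_assoc[symmetric] subset_iff)
next
  fix x assume "x \<in> carrier K" "inv g \<otimes> x \<in> A"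
  moreover from this have "x = g \<otimes> (inv g \<otimes> x)"
    using assms by (simp add: m_assoc[symmetric])
  ultimately show "x \<in> g <# A" by (auto simp: l_coset_def)
qed

lemma r_coset_eq_preimage:
  assumes "g \<in> carrier K" "A \<subseteq> carrier K"
  shows "A #> g = {x \<in> carrier K. x \<otimes> inv g \<in> A}"
proof safe
  fix x assume "x \<in> A #> g"
  then obtain a where a: "a \<in> A" "x = a \<otimes> g" by (auto simp: r_coset_def)
  then show "x \<in> carrier K" "x \<otimes> inv g \<in> A"
    using assms by (auto simp: m_assoc subset_iff)
next
  fix x assume "x \<in> carrier K" "x \<otimes> inv g \<in> A"
  moreover from this have "x = x \<otimes> inv g \<otimes> g"
    using assms by (simp add: m_assoc)
  ultimately show "x \<in> A #> g" unfolding r_coset_def by blast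
qed

lemma openin_l_coset:
  assumes "g \<in> carrier K" "openin T U"
  shows "openin T (g <# U)"
proof -
  have "continuous_map T T (\<lambda>x. inv g \<otimes> x)"
    using assms by (intro continuous_map_mult) auto
  from openin_continuous_map_preimage[OF this assms(2)]
  show ?thesis
    using assms l_coset_eq_preimage[of g U] openin_subset[of T U] by simp
qed

lemma openin_r_coset:
  assumes "g \<in> carrier K" "openin T U"
  shows "openin T (U #> g)"
proof -
  have "continuous_map T T (\<lambda>x. x \<otimes> inv g)"
    using assms by (intro continuous_map_mult) auto
  from openin_continuous_map_preimage[OF this assms(2)]
  show ?thesis
    using assms r_coset_eq_preimage[of g U] openin_subset[of T U] by simp
qed

lemma l_coset_borel:
  assumes "g \<in> carrier K" "A \<in> sets (borel_of T)"
  shows "g <# A \<in> sets (borel_of T)"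
proof -
  have "(\<lambda>x. inv g \<otimes> x) \<in> measurable (borel_of T) (borel_of T)"
    using assms by (intro measurable_borel_of_continuous_map continuous_map_mult) auto
  from measurable_sets[OF this assms(2)]
  show ?thesis
    using assms l_coset_eq_preimage[of g A] sets.sets_into_space[OF assms(2)]
    by (simp add: vimage_def Int_def conj_commute)
qed

lemma openin_set_mult:
  assumes "openin T U" "B \<subseteq> carrier K"
  shows "openin T (U <#> B)"
proof -
  have "U <#> B = (\<Union>b\<in>B. U #> b)"
    by (auto simp: set_mult_def r_coset_def)
  also have "openin T \<dots>" using assms by (auto intro!: openin_r_coset)
  finally show ?thesis .
qed

text \<open>Compactness is essential: the product is the continuous image of a compact
  rectangle.\<close>

lemma closedin_set_mult:
  assumes "closedin T A" "closedin T B"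
  shows "closedin T (A <#> B)"
proof -
  have "compactin (prod_topology T T) (A \<times> B)"
    using assms compact closedin_compact_space by (auto simp: compactin_Times)
  from image_compactin[OF this continuous_mult]
  have "compactin T ((\<lambda>(x, y). x \<otimes> y) ` (A \<times> B))" .
  moreover have "(\<lambda>(x, y). x \<otimes> y) ` (A \<times> B) = A <#> B"
    by (auto simp: set_mult_def)
  ultimately show ?thesis
    using Hausdorff compactin_imp_closedin by metis
qed

lemma in_set_mult: "x \<in> A <#> B \<longleftrightarrow> (\<exists>a\<in>A. \<exists>b\<in>B. x = a \<otimes> b)"
  by (auto simp: set_mult_def)

text \<open>A tube lemma that replaces the topology of \<open>K / R\<close>. The complement of
  \<open>(K - U) R\<close> works: this product is closed, and it contains every \<open>x\<close>
  with some \<open>x r\<close> outside \<open>U\<close>, because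
  \<open>x = (x r) r^-1\<close>.\<close>

lemma saturated_open_subset:
  assumes R: "subgroup R K" "closedin T R" and U: "openin T U" "R \<subseteq> U"
  obtains U' where "openin T U'" "R \<subseteq> U'" "U' <#> R \<subseteq> U"
proof
  interpret R: subgroup R K by fact
  let ?U' = "carrier K - ((carrier K - U) <#> R)"
  have "closedin T ((carrier K - U) <#> R)"
    using closedin_set_mult[OF _ R(2)] U(1) by fastforce
  then show "openin T ?U'"
    by (metis openin_closedin_eq openin_diff openin_topspace topspace)
  show "R \<subseteq> ?U'"
  proof clarify
    fix r assume r: "r \<in> R"
    have False if yr: "y \<in> carrier K" "y \<notin> U" "r' \<in> R" "r = y \<otimes> r'" for y r'
    proof -
      have "y = r \<otimes> inv r'"
        unfolding yr(4) using yr(1,3) by (simp add: m_assoc)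
      then have "y \<in> R" using r yr(3) R.m_closed[of r "inv r'"] by simp
      then show False using yr U by blast
    qed
    then show "r \<in> ?U'" using r by (auto simp: in_set_mult)
  qed
  show "?U' <#> R \<subseteq> U"
  proof
    fix z assume "z \<in> ?U' <#> R"
    then obtain x r where xr: "x \<in> ?U'" "r \<in> R" "z = x \<otimes> r" by (auto simp: in_set_mult)
    show "z \<in> U"
    proof (rule ccontr)
      assume "z \<notin> U"
      moreover have "x = z \<otimes> inv r" "z \<in> carrier K"
        using xr by (auto simp: m_assoc)
      ultimately have "x \<in> (carrier K - U) <#> R"
        using xr(2) by (auto simp: in_set_mult)
      then show False using xr by blast
    qed
  qed
qed

end

section \<open>Haar measure\<close>

context compact_group
begin

lemma haar_unique:
  assumes \<mu>: "normalized_haar_measure K T \<mu>" and \<nu>: "normalized_haar_measure K T \<nu>"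
  shows "\<mu> = \<nu>"
proof -
  \<comment> \<open>Fubini for the pairs \<open>(x, y)\<close> with \<open>y^-1 x\<close> in
    \<open>A\<close>: the section at \<open>x\<close> is \<open>x A^-1\<close>, the section at
    \<open>y\<close> is \<open>y A\<close>. Only left invariance is used. The instance with both
    measures equal to \<nu> shows that \<nu> is preserved by inversion, which removes the inverse at
    the end.\<close>
  have *: "emeasure \<mu> A = emeasure \<nu> {x \<in> carrier K. inv x \<in> A}"
    if \<mu>: "normalized_haar_measure K T \<mu>" and \<nu>: "normalized_haar_measure K T \<nu>"
      and A: "A \<in> sets (borel_of T)" for \<mu> \<nu> A
  proof -
    have s [measurable_cong]: "sets \<mu> = sets (borel_of T)" "sets \<nu> = sets (borel_of T)"
      using \<mu> \<nu> by (auto simp: normalized_haar_measure_def)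
    then have sp: "space \<mu> = carrier K" "space \<nu> = carrier K"
      by (auto dest: sets_eq_imp_space_eq)
    interpret \<mu>: finite_measure \<mu>
      using \<mu> by (intro finite_measureI) (simp add: sp normalized_haar_measure_def)
    interpret \<nu>: finite_measure \<nu>
      using \<nu> by (intro finite_measureI) (simp add: sp normalized_haar_measure_def)
    interpret pair_sigma_finite \<mu> \<nu> ..
    have A': "A \<subseteq> carrier K" using sets.sets_into_space[OF A] by simp
    have "continuous_map (prod_topology T T) T (\<lambda>z. inv (snd z) \<otimes> fst z)"
      by (intro continuous_map_mult continuous_map_inv continuous_map_fst continuous_map_snd)
    then have m: "(\<lambda>z. inv (snd z) \<otimes> fst z) \<in> measurable (\<mu> \<Otimes>\<^sub>M \<nu>) (borel_of T)"
      using measurable_pair_borel_of_continuous_map[OF second_countable second_countable]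
      by (subst measurable_cong_sets[OF sets_pair_measure_cong[OF s] refl]) blast
    let ?S = "{z \<in> space (\<mu> \<Otimes>\<^sub>M \<nu>). inv (snd z) \<otimes> fst z \<in> A}"
    have S: "?S \<in> sets (\<mu> \<Otimes>\<^sub>M \<nu>)"
      using measurable_sets[OF m A] by (simp add: vimage_def Int_def conj_commute)
    have inv_m: "{x \<in> carrier K. inv x \<in> A} \<in> sets \<nu>"
      using measurable_sets[OF measurable_borel_of_continuous_map[OF continuous_inv] A]
      by (simp add: vimage_def Int_def conj_commute s)
    have 1: "Pair x -` ?S = x <# {x \<in> carrier K. inv x \<in> A}" if "x \<in> carrier K" for x
      using that by (auto simp: l_coset_eq_preimage space_pair_measure sp inv_mult_group)
    have 2: "(\<lambda>x. (x, y)) -` ?S = y <# A" if "y \<in> carrier K" for y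
      using that A' by (auto simp: l_coset_eq_preimage space_pair_measure sp)
    have "emeasure (\<mu> \<Otimes>\<^sub>M \<nu>) ?S = (\<integral>\<^sup>+x. emeasure \<nu> {x \<in> carrier K. inv x \<in> A} \<partial>\<mu>)"
      unfolding \<nu>.emeasure_pair_measure_alt[OF S]
    proof (rule nn_integral_cong)
      fix x assume "x \<in> space \<mu>"
      then have x: "x \<in> carrier K" by (simp add: sp)
      show "emeasure \<nu> (Pair x -` ?S) = emeasure \<nu> {x \<in> carrier K. inv x \<in> A}"
        using \<nu> inv_m x unfolding 1[OF x] normalized_haar_measure_def by blast
    qed
    also have "\<dots> = emeasure \<nu> {x \<in> carrier K. inv x \<in> A}"
      using \<mu> by (simp add: normalized_haar_measure_def sp)
    finally have "emeasure (\<mu> \<Otimes>\<^sub>M \<nu>) ?S = emeasure \<nu> {x \<in> carrier K. inv x \<in> A}" .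
    moreover have "emeasure (\<mu> \<Otimes>\<^sub>M \<nu>) ?S = (\<integral>\<^sup>+y. emeasure \<mu> A \<partial>\<nu>)"
      unfolding emeasure_pair_measure_alt2[OF S]
    proof (rule nn_integral_cong)
      fix y assume "y \<in> space \<nu>"
      then have y: "y \<in> carrier K" by (simp add: sp)
      show "emeasure \<mu> ((\<lambda>x. (x, y)) -` ?S) = emeasure \<mu> A"
        using \<mu> A y s unfolding 2[OF y] normalized_haar_measure_def by blast
    qed
    then have "emeasure (\<mu> \<Otimes>\<^sub>M \<nu>) ?S = emeasure \<mu> A"
      using \<nu> by (simp add: normalized_haar_measure_def sp)
    ultimately show ?thesis by simp
  qed
  show ?thesis
  proof (rule measure_eqI)
    show s: "sets \<mu> = sets \<nu>"
      using \<mu> \<nu> by (simp add: normalized_haar_measure_def)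
    show "emeasure \<mu> A = emeasure \<nu> A" if "A \<in> sets \<mu>" for A
      using that *[OF \<mu> \<nu>, of A] *[OF \<nu> \<nu>, of A] \<mu>
      by (simp add: normalized_haar_measure_def)
  qed
qed

end

locale haar_group = compact_group K T for K (structure) and T :: "'a topology" +
  fixes \<omega> :: "'a measure"
  assumes haar: "normalized_haar_measure K T \<omega>"
begin

lemma sets_haar [simp, measurable_cong]: "sets \<omega> = sets (borel_of T)"
  using haar by (simp add: normalized_haar_measure_def)

lemma space_haar [simp]: "space \<omega> = carrier K"
  using sets_eq_imp_space_eq[OF sets_haar] by simp

sublocale finite_measure \<omega>
  using haar by (intro finite_measureI) (simp add: normalized_haar_measure_def)

lemma measure_carrier: "measure \<omega> (carrier K) = 1"
  using haar by (simp add: normalized_haar_measure_def measure_def)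

lemma measure_l_coset:
  assumes "g \<in> carrier K" "A \<in> sets (borel_of T)"
  shows "measure \<omega> (g <# A) = measure \<omega> A"
  using haar assms by (simp add: normalized_haar_measure_def measure_def)

text \<open>Finitely many translates of \<open>U\<close> cover \<open>K\<close>, all of the same
  measure.\<close>

lemma measure_open_pos:
  assumes U: "openin T U" "U \<noteq> {}"
  shows "measure \<omega> U > 0"
proof (rule ccontr)
  assume "\<not> measure \<omega> U > 0"
  then have 0: "measure \<omega> U = 0" by (simp add: not_less measure_le_0_iff)
  have sub: "U \<subseteq> carrier K" using openin_subset[OF U(1)] by simp
  obtain u where u: "u \<in> U" using U(2) by blast
  let ?\<U> = "(\<lambda>g. g <# U) ` carrier K"
  have "x \<in> (x \<otimes> inv u) <# U" if "x \<in> carrier K" for x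
    unfolding l_coset_def using that u sub by (auto simp: m_assoc subset_iff intro!: bexI[of _ u])
  then have "carrier K \<subseteq> \<Union>?\<U>"
    using u sub by (auto simp: subset_iff) blast
  moreover have "\<forall>V\<in>?\<U>. openin T V"
    using U(1) openin_l_coset by blast
  ultimately obtain \<F> where F: "finite \<F>" "\<F> \<subseteq> ?\<U>" "carrier K \<subseteq> \<Union>\<F>"
    using compact unfolding compact_space_def compactin_def by (metis topspace)
  obtain G where G: "finite G" "G \<subseteq> carrier K" "\<F> = (\<lambda>g. g <# U) ` G"
    using finite_subset_image[OF F(1,2)] by blast
  have "1 = measure \<omega> (carrier K)" by (simp add: measure_carrier)
  also have "\<dots> \<le> measure \<omega> (\<Union>g\<in>G. g <# U)"
    using F(3) G U(1) by (intro finite_measure_mono sets.finite_UN) (auto intro: l_coset_borel)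
  also have "\<dots> \<le> (\<Sum>g\<in>G. measure \<omega> (g <# U))"
    using G U(1) by (intro finite_measure_subadditive_finite) (auto intro: l_coset_borel)
  also have "\<dots> = 0"
    using G U(1) 0 by (intro sum.neutral) (auto simp: measure_l_coset borel_of_openin subset_iff)
  finally show False by simp
qed

text \<open>The image measure of \<omega> under \<open>f\<close> is again a normalized Haar measure:
  if \<open>f h = g\<close>, the preimage of \<open>g A\<close> is \<open>h\<close> times the
  preimage of \<open>A\<close>. Uniqueness then identifies it with \<omega>.\<close>

lemma measure_homeomorphic_automorphism:
  assumes f: "f \<in> hom K K" "bij_betw f (carrier K) (carrier K)" "continuous_map T T f"
    and A: "A \<in> sets (borel_of T)"
  shows "measure \<omega> {x \<in> carrier K. f x \<in> A} = measure \<omega> A"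
proof -
  have fm: "f \<in> measurable \<omega> (borel_of T)"
    using measurable_borel_of_continuous_map[OF f(3)] by simp
  have "normalized_haar_measure K T (distr \<omega> (borel_of T) f)"
    unfolding normalized_haar_measure_def
  proof (intro conjI ballI)
    have "f -` carrier K \<inter> carrier K = carrier K"
      using f(2) by (auto simp: bij_betw_def)
    then show "emeasure (distr \<omega> (borel_of T) f) (carrier K) = 1"
      using haar sets.top[of "borel_of T"] by (subst emeasure_distr[OF fm]) (auto simp: normalized_haar_measure_def)
  next
    fix g A assume g: "g \<in> carrier K" and A: "A \<in> sets (distr \<omega> (borel_of T) f)"
    then have A: "A \<in> sets (borel_of T)" "A \<subseteq> carrier K"
      using sets.sets_into_space[of A "borel_of T"] by auto
    obtain h where h: "h \<in> carrier K" "f h = g"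
      using f(2) g unfolding bij_betw_def by (metis imageE)
    have fh: "f (inv h \<otimes> x) = inv g \<otimes> f x" if "x \<in> carrier K" for x
    proof -
      interpret group_hom K K f
        using f(1) by (simp add: group_hom_def group_hom_axioms_def group_axioms)
      show ?thesis using that h by simp
    qed
    have fc: "f x \<in> carrier K" if "x \<in> carrier K" for x
      using f(2) that by (auto simp: bij_betw_def)
    have "f -` (g <# A) \<inter> carrier K = h <# (f -` A \<inter> carrier K)"
      using g h A(2) by (auto simp: l_coset_eq_preimage fh fc)
    moreover have "f -` A \<inter> carrier K \<in> sets (borel_of T)"
      using measurable_sets[OF fm A(1)] by simp
    ultimately show "emeasure (distr \<omega> (borel_of T) f) (g <# A) = emeasure (distr \<omega> (borel_of T) f) A"
      using haar h(1) A(1) g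
      by (simp add: emeasure_distr[OF fm] l_coset_borel normalized_haar_measure_def)
  qed simp
  then have "distr \<omega> (borel_of T) f = \<omega>"
    using haar_unique haar by blast
  then have "measure \<omega> A = measure (distr \<omega> (borel_of T) f) A" by simp
  also have "\<dots> = measure \<omega> {x \<in> carrier K. f x \<in> A}"
    using A by (simp add: measure_distr[OF fm] vimage_def Int_def conj_commute)
  finally show ?thesis by simp
qed

text \<open>This is the L1 distance between the indicator functions of \<open>A\<close> and
  \<open>g A\<close>. For Borel \<open>A\<close> it is a pseudonorm on \<open>K\<close> that
  vanishes exactly on the elements preserving \<open>A\<close> up to a null set.\<close>

definition translate_dist :: "'a set \<Rightarrow> 'a \<Rightarrow> real" where
  "translate_dist A g = measure \<omega> (sym_diff A (g <# A))"

lemma translate_dist_nonneg: "translate_dist A g \<ge> 0"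
  by (simp add: translate_dist_def)

lemma translate_dist_one:
  assumes "A \<in> sets (borel_of T)" shows "translate_dist A \<one> = 0"
proof -
  have "\<one> <# A = A"
    using sets.sets_into_space[OF assms] by (simp add: lcos_mult_one)
  then show ?thesis by (simp add: translate_dist_def)
qed

lemma l_coset_Diff:
  assumes "g \<in> carrier K" "A \<subseteq> carrier K" "B \<subseteq> carrier K"
  shows "g <# (A - B) = (g <# A) - (g <# B)"
  using assms l_coset_eq_preimage[of g "A - B"] l_coset_eq_preimage[of g A]
    l_coset_eq_preimage[of g B] by auto

lemma l_coset_Un: "g <# (A \<union> B) = (g <# A) \<union> (g <# B)"
  by (auto simp: l_coset_def)

text \<open>Triangle inequality through \<open>g A\<close>; the second difference is the translate
  by \<open>g\<close> of the one between \<open>A\<close> and \<open>h A\<close>, so left invariance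
  applies.\<close>

lemma translate_dist_mult:
  assumes A: "A \<in> sets (borel_of T)" and gh: "g \<in> carrier K" "h \<in> carrier K"
  shows "translate_dist A (g \<otimes> h) \<le> translate_dist A g + translate_dist A h"
proof -
  have A': "A \<subseteq> carrier K" using sets.sets_into_space[OF A] by simp
  have hA: "h <# A \<subseteq> carrier K" using A' gh l_coset_eq_preimage by auto
  have eq: "(g \<otimes> h) <# A = g <# (h <# A)"
    using A' gh by (simp add: lcos_m_assoc)
  have "translate_dist A (g \<otimes> h) \<le> measure \<omega> (sym_diff A (g <# A) \<union> sym_diff (g <# A) (g <# (h <# A)))"
    unfolding translate_dist_def eq
    by (intro finite_measure_mono) (use A gh in \<open>auto intro!: sets.Diff sets.Un l_coset_borel\<close>)
  also have "\<dots> \<le> translate_dist A g + measure \<omega> (sym_diff (g <# A) (g <# (h <# A)))"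
    unfolding translate_dist_def
    by (intro measure_Un_le) (use A gh in \<open>auto intro!: sets.Diff sets.Un l_coset_borel\<close>)
  also have "sym_diff (g <# A) (g <# (h <# A)) = g <# (sym_diff A (h <# A))"
    using gh A' hA by (simp add: l_coset_Diff l_coset_Un)
  also have "measure \<omega> \<dots> = translate_dist A h"
    unfolding translate_dist_def
    by (intro measure_l_coset) (use A gh in \<open>auto intro!: sets.Diff sets.Un l_coset_borel\<close>)
  finally show ?thesis .
qed

lemma translate_dist_inv:
  assumes A: "A \<in> sets (borel_of T)" and g: "g \<in> carrier K"
  shows "translate_dist A (inv g) = translate_dist A g"
proof -
  have A': "A \<subseteq> carrier K" using sets.sets_into_space[OF A] by simp
  have gA: "g <# A \<subseteq> carrier K" using A' g l_coset_eq_preimage by auto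
  have "translate_dist A g = measure \<omega> (inv g <# (sym_diff A (g <# A)))"
    unfolding translate_dist_def
    by (intro measure_l_coset[symmetric]) (use A g in \<open>auto intro!: sets.Diff sets.Un l_coset_borel\<close>)
  also have "inv g <# (sym_diff A (g <# A)) = sym_diff (inv g <# A) A"
    using g A' gA by (simp add: l_coset_Diff l_coset_Un lcos_m_assoc lcos_mult_one)
  finally show ?thesis by (simp add: translate_dist_def Un_commute)
qed

lemma translate_dist_automorphism:
  assumes f: "f \<in> hom K K" "bij_betw f (carrier K) (carrier K)" "continuous_map T T f"
    and A: "A \<in> sets (borel_of T)" and g: "g \<in> carrier K"
  shows "translate_dist {x \<in> carrier K. f x \<in> A} g = translate_dist A (f g)"
proof -
  have A': "A \<subseteq> carrier K" using sets.sets_into_space[OF A] by simp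
  have fc: "f x \<in> carrier K" if "x \<in> carrier K" for x
    using f(2) that by (auto simp: bij_betw_def)
  have fh: "f (inv g \<otimes> x) = inv (f g) \<otimes> f x" if "x \<in> carrier K" for x
  proof -
    interpret group_hom K K f
      using f(1) by (simp add: group_hom_def group_hom_axioms_def group_axioms)
    show ?thesis using that g by simp
  qed
  have "g <# {x \<in> carrier K. f x \<in> A} = {x \<in> carrier K. f x \<in> f g <# A}"
    using g A' l_coset_eq_preimage[of g "{x \<in> carrier K. f x \<in> A}"]
      l_coset_eq_preimage[of "f g" A] by (auto simp: fh fc)
  then have "sym_diff {x \<in> carrier K. f x \<in> A} (g <# {x \<in> carrier K. f x \<in> A})
      = {x \<in> carrier K. f x \<in> sym_diff A (f g <# A)}"
    by auto
  then show ?thesis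
    unfolding translate_dist_def
    using measure_homeomorphic_automorphism[OF f, of "sym_diff A (f g <# A)"] A fc[OF g]
    by (simp add: sets.Diff sets.Un l_coset_borel)
qed

text \<open>Otherwise conditioning \<omega> on \<open>A\<close> gives another left invariant
  probability measure. By uniqueness it is \<omega>, but it gives \<open>A\<close> measure
  1.\<close>

lemma measure_translation_invariant:
  assumes A: "A \<in> sets (borel_of T)" and 0: "\<And>g. g \<in> carrier K \<Longrightarrow> translate_dist A g = 0"
  shows "measure \<omega> A \<in> {0, 1}"
proof (rule ccontr)
  assume n: "measure \<omega> A \<notin> {0, 1}"
  then have "emeasure \<omega> A \<noteq> 0" by (auto simp: measure_def)
  then have div: "emeasure \<omega> A / emeasure \<omega> A = 1"
    by (intro ennreal_divide_self) (simp_all add: emeasure_eq_measure)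
  define \<nu> where "\<nu> = density \<omega> (\<lambda>x. indicator A x / emeasure \<omega> A)"
  have A': "A \<subseteq> carrier K" using sets.sets_into_space[OF A] by simp
  have emeas: "emeasure \<nu> B = emeasure \<omega> (A \<inter> B) / emeasure \<omega> A" if "B \<in> sets (borel_of T)" for B
  proof -
    have "emeasure \<nu> B = (\<integral>\<^sup>+x. indicator (A \<inter> B) x / emeasure \<omega> A \<partial>\<omega>)"
      unfolding \<nu>_def using that A
      by (subst emeasure_density) (auto intro!: nn_integral_cong simp: indicator_def)
    also have "\<dots> = emeasure \<omega> (A \<inter> B) / emeasure \<omega> A"
      using that A by (subst nn_integral_divide) auto
    finally show ?thesis .
  qed
  have "normalized_haar_measure K T \<nu>"
    unfolding normalized_haar_measure_def
  proof (intro conjI ballI)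
    show "sets \<nu> = sets (borel_of T)" by (simp add: \<nu>_def)
    show "emeasure \<nu> (carrier K) = 1"
      using emeas[of "carrier K"] A' div sets.top[of "borel_of T"]
      by (simp add: Int_absorb2)
  next
    fix g B assume g: "g \<in> carrier K" and B: "B \<in> sets \<nu>"
    then have B: "B \<in> sets (borel_of T)" "B \<subseteq> carrier K"
      using sets.sets_into_space[of B "borel_of T"] by (auto simp: \<nu>_def)
    have "emeasure \<omega> (sym_diff A (g <# A)) = 0"
      using 0[OF g] by (simp add: translate_dist_def emeasure_eq_measure)
    \<comment> \<open>Off the null set \<open>sym_diff A (g <# A)\<close>, membership in
      \<open>A\<close> and in \<open>g A\<close> agree.\<close>
    then have "emeasure \<omega> (A \<inter> (g <# B)) = emeasure \<omega> ((g <# A) \<inter> (g <# B))"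
      using A B(1) g
      by (intro emeasure_eq_AE AE_I[where N = "sym_diff A (g <# A)"])
         (auto intro!: sets.Diff sets.Un sets.Int l_coset_borel)
    also have "(g <# A) \<inter> (g <# B) = g <# (A \<inter> B)"
      using g A' B(2) by (auto simp: l_coset_eq_preimage le_infI1)
    also have "emeasure \<omega> \<dots> = emeasure \<omega> (A \<inter> B)"
      using haar g A B(1) by (simp add: normalized_haar_measure_def)
    finally show "emeasure \<nu> (g <# B) = emeasure \<nu> B"
      using g B(1) by (simp add: emeas l_coset_borel)
  qed
  then have "\<nu> = \<omega>" using haar haar_unique by blast
  then have "emeasure \<omega> A = emeasure \<omega> A / emeasure \<omega> A"
    using emeas[OF A] by simp
  also have "\<dots> = 1" by (rule div)
  finally show False using n by (simp add: measure_def)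
qed

end

section \<open>Displacement of a Borel set under translation\<close>

context compact_group
begin

lemma nbhd_base_one:
  obtains V :: "nat \<Rightarrow> 'a set"
  where "\<And>n. openin T (V n)" "\<And>n. \<one> \<in> V n"
    "\<And>U. openin T U \<Longrightarrow> \<one> \<in> U \<Longrightarrow> \<exists>N. \<forall>n\<ge>N. V n \<subseteq> U"
proof -
  obtain M d where "Metric_space M d" and T: "T = Metric_space.mtopology M d"
    using metrizable by (auto simp: metrizable_space_def)
  interpret Metric_space M d by fact
  have M: "M = carrier K"
    using topspace unfolding T by simp
  show thesis
  proof (rule that[of "\<lambda>n. mball \<one> (inverse (Suc n))"])
    show "openin T (mball \<one> (inverse (Suc n)))" for n by (simp add: T)
    have "\<one> \<in> M" by (simp add: M)
    then show "\<one> \<in> mball \<one> (inverse (Suc n))" for n by simp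
    fix U assume "openin T U" "\<one> \<in> U"
    then obtain r where r: "r > 0" "mball \<one> r \<subseteq> U"
      unfolding T openin_mtopology by blast
    obtain N where N: "inverse (real (Suc N)) < r"
      using reals_Archimedean[of r] r(1) by auto
    have "mball \<one> (inverse (Suc n)) \<subseteq> U" if "n \<ge> N" for n
    proof -
      have "inverse (real (Suc n)) \<le> inverse (real (Suc N))"
        using that by (simp add: le_imp_inverse_le)
      then have "mball \<one> (inverse (Suc n)) \<subseteq> mball \<one> r"
        using N by (intro mball_subset_concentric) linarith
      then show ?thesis using r(2) by blast
    qed
    then show "\<exists>N. \<forall>n\<ge>N. mball \<one> (inverse (Suc n)) \<subseteq> U" by blast
  qed
qed

end

context haar_group
begin

lemma borel_subset: "A \<in> sets (borel_of T) \<Longrightarrow> A \<subseteq> carrier K"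
  using sets.sets_into_space[of A "borel_of T"] by simp

lemma sym_diff_borel:
  assumes "A \<in> sets (borel_of T)" "g \<in> carrier K"
  shows "sym_diff A (g <# A) \<in> sets (borel_of T)"
  using assms by (intro sets.Un sets.Diff l_coset_borel)

text \<open>As \<open>A\<close> and \<open>g A\<close> have equal measure, the two halves of the
  symmetric difference do too. For open sets this matters: only \<open>A - g A\<close> can be
  controlled pointwise, since a boundary point of \<open>A\<close> may lie in \<open>g A\<close> for
  \<open>g\<close> arbitrarily close to 1.\<close>

lemma translate_dist_eq:
  assumes A: "A \<in> sets (borel_of T)" and g: "g \<in> carrier K"
  shows "translate_dist A g = 2 * measure \<omega> (A - (g <# A))"
proof -
  have gA: "g <# A \<in> sets (borel_of T)" using assms by (rule l_coset_borel[rotated])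
  have "translate_dist A g = measure \<omega> (A - (g <# A)) + measure \<omega> ((g <# A) - A)"
    unfolding translate_dist_def using A gA by (intro finite_measure_Union) auto
  moreover have "measure \<omega> (A - (g <# A)) = measure \<omega> A - measure \<omega> (A \<inter> (g <# A))"
    using A gA by (intro finite_measure_Diff') auto
  moreover have "measure \<omega> ((g <# A) - A) = measure \<omega> (g <# A) - measure \<omega> ((g <# A) \<inter> A)"
    using A gA by (intro finite_measure_Diff') auto
  ultimately show ?thesis
    using measure_l_coset[OF g A] by (simp add: Int_commute)
qed

text \<open>If \<open>g n\<close> tends to 1, each point of the open set \<open>U\<close> lies in
  \<open>g n U\<close> for all large \<open>n\<close>. The tails \<open>B n\<close> therefore
  decrease to the empty set, and continuity from above contradicts a lower bound on the
  displacements.\<close>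

lemma translate_dist_small_open:
  assumes U: "openin T U" and "\<epsilon> > 0"
  shows "\<exists>V. openin T V \<and> \<one> \<in> V \<and> (\<forall>g\<in>V. translate_dist U g < \<epsilon>)"
proof (rule ccontr)
  assume *: "\<not> ?thesis"
  have UB: "U \<in> sets (borel_of T)" using U by auto
  obtain V :: "nat \<Rightarrow> 'a set" where V: "\<And>n. openin T (V n)" "\<And>n. \<one> \<in> V n"
    "\<And>U. openin T U \<Longrightarrow> \<one> \<in> U \<Longrightarrow> \<exists>N. \<forall>n\<ge>N. V n \<subseteq> U"
    using nbhd_base_one by metis
  have "\<forall>n. \<exists>g\<in>V n. \<epsilon> \<le> translate_dist U g"
    using * V(1,2) by (meson not_less)
  then obtain g where g: "\<And>n. g n \<in> V n" "\<And>n. \<epsilon> \<le> translate_dist U (g n)"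
    by metis
  have gK: "g n \<in> carrier K" for n
    using g(1)[of n] openin_subset[OF V(1)[of n]] by auto
  define B where "B n = (\<Union>m\<in>{n..}. U - (g m <# U))" for n
  have B: "range B \<subseteq> sets \<omega>"
    unfolding B_def using UB gK by (auto intro!: sets.countable_UN' sets.Diff l_coset_borel)
  have empty: "(\<Inter>n. B n) = {}"
  proof (rule ccontr)
    assume "(\<Inter>n. B n) \<noteq> {}"
    then obtain x where x: "\<And>n. x \<in> B n" by blast
    from x[of 0] have xU: "x \<in> U" by (auto simp: B_def)
    then have xK: "x \<in> carrier K" using borel_subset[OF UB] by blast
    have "continuous_map T T (\<lambda>y. inv y \<otimes> x)"
      using xK by (intro continuous_map_mult continuous_inv) auto
    from openin_continuous_map_preimage[OF this U]
    obtain N where N: "\<forall>n\<ge>N. V n \<subseteq> {y \<in> carrier K. inv y \<otimes> x \<in> U}"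
      using V(3)[of "{y \<in> carrier K. inv y \<otimes> x \<in> U}"] xU xK by auto
    have "x \<in> g n <# U" if "n \<ge> N" for n
      using N that g(1)[of n] xK gK[of n] borel_subset[OF UB] by (auto simp: l_coset_eq_preimage)
    then have "x \<notin> B N" by (auto simp: B_def)
    then show False using x by blast
  qed
  have "decseq B"
    unfolding B_def by (intro antimonoI) (auto intro: order_trans)
  then have "(\<lambda>n. measure \<omega> (B n)) \<longlonglongrightarrow> measure \<omega> (\<Inter>n. B n)"
    using B by (intro finite_Lim_measure_decseq) auto
  then have "(\<lambda>n. measure \<omega> (B n)) \<longlonglongrightarrow> 0" by (simp add: empty)
  moreover have "\<epsilon> / 2 \<le> measure \<omega> (B n)" for n
  proof -
    have "\<epsilon> / 2 \<le> measure \<omega> (U - (g n <# U))"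
      using g(2)[of n] translate_dist_eq[OF UB gK] by simp
    also have "\<dots> \<le> measure \<omega> (B n)"
      using B by (intro finite_measure_mono) (auto simp: B_def)
    finally show ?thesis .
  qed
  ultimately have "\<epsilon> / 2 \<le> 0"
    by (intro LIMSEQ_le_const) auto
  then show False using \<open>\<epsilon> > 0\<close> by simp
qed

text \<open>Outside the differences of the first \<open>n\<close> sets, a point of the symmetric
  difference lies in the remainder of the union or in its translate; hence the factor 2.\<close>

lemma translate_dist_countable_Union_le:
  fixes A :: "nat \<Rightarrow> 'a set"
  assumes A: "\<And>i. A i \<in> sets (borel_of T)" and g: "g \<in> carrier K"
  shows "translate_dist (\<Union>i. A i) g
    \<le> 2 * measure \<omega> ((\<Union>i. A i) - (\<Union>i<n. A i)) + (\<Sum>i<n. translate_dist (A i) g)"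
proof -
  let ?A = "\<Union>i. A i" and ?B = "\<Union>i<n. A i"
  have B: "?A - ?B \<in> sets (borel_of T)" "?A \<in> sets (borel_of T)" "?B \<in> sets (borel_of T)"
    using A by auto
  have gB: "g <# (?A - ?B) \<in> sets (borel_of T)"
    using g B(1) by (rule l_coset_borel)
  have S: "(\<Union>i<n. sym_diff (A i) (g <# A i)) \<in> sets (borel_of T)"
    using A g by (intro sets.finite_UN sym_diff_borel) auto
  have "sym_diff ?A (g <# ?A) \<subseteq> (?A - ?B) \<union> (g <# (?A - ?B)) \<union> (\<Union>i<n. sym_diff (A i) (g <# A i))"
  proof -
    have eq: "g <# ?A = {x \<in> carrier K. inv g \<otimes> x \<in> ?A}"
      "g <# (?A - ?B) = {x \<in> carrier K. inv g \<otimes> x \<in> ?A - ?B}"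
      "\<And>i. g <# A i = {x \<in> carrier K. inv g \<otimes> x \<in> A i}"
      using l_coset_eq_preimage[OF g] borel_subset A B by blast+
    show ?thesis unfolding eq using borel_subset[OF A] by blast
  qed
  then have "translate_dist ?A g
      \<le> measure \<omega> ((?A - ?B) \<union> (g <# (?A - ?B)) \<union> (\<Union>i<n. sym_diff (A i) (g <# A i)))"
    unfolding translate_dist_def using B gB S by (intro finite_measure_mono) auto
  also have "\<dots> \<le> measure \<omega> ((?A - ?B) \<union> (g <# (?A - ?B)))
      + measure \<omega> (\<Union>i<n. sym_diff (A i) (g <# A i))"
    using B gB S by (intro measure_Un_le) auto
  also have "\<dots> \<le> (measure \<omega> (?A - ?B) + measure \<omega> (g <# (?A - ?B)))
      + (\<Sum>i<n. translate_dist (A i) g)"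
    unfolding translate_dist_def
  proof (rule add_mono)
    show "measure \<omega> ((?A - ?B) \<union> (g <# (?A - ?B))) \<le> measure \<omega> (?A - ?B) + measure \<omega> (g <# (?A - ?B))"
      using B gB by (intro measure_Un_le) auto
    show "measure \<omega> (\<Union>i<n. sym_diff (A i) (g <# A i)) \<le> (\<Sum>i<n. measure \<omega> (sym_diff (A i) (g <# A i)))"
      using A g sym_diff_borel by (intro finite_measure_subadditive_finite) auto
  qed
  also have "measure \<omega> (g <# (?A - ?B)) = measure \<omega> (?A - ?B)"
    using g B(1) by (rule measure_l_coset)
  finally show ?thesis by simp
qed

text \<open>Induction over the generated sigma-algebra takes the place of approximation by open
  sets, so no regularity of \<omega> has to be proved.\<close>

lemma translate_dist_small:
  assumes "A \<in> sets (borel_of T)" and "\<epsilon> > 0"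
  shows "\<exists>V. openin T V \<and> \<one> \<in> V \<and> (\<forall>g\<in>V. translate_dist A g < \<epsilon>)"
proof -
  have "sets (borel_of T) = sigma_sets (carrier K) {U. openin T U}"
    by (simp add: sets_borel_of)
  with assms(1) have "A \<in> sigma_sets (carrier K) {U. openin T U}" by simp
  then show ?thesis using \<open>\<epsilon> > 0\<close>
  proof (induction arbitrary: \<epsilon> rule: sigma_sets.induct)
    case (Basic U)
    then show ?case using translate_dist_small_open by simp
  next
    case Empty
    show ?case using translate_dist_small_open[of "{}"] Empty by simp
  next
    case (Compl A)
    have "{U. openin T U} \<subseteq> Pow (carrier K)"
      using openin_subset[of T] by (metis PowI mem_Collect_eq subsetI topspace)
    then have A: "A \<subseteq> carrier K"
      using Compl(1) by (rule sigma_sets_into_sp)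
    have "translate_dist (carrier K - A) g = translate_dist A g" if "g \<in> carrier K" for g
    proof -
      have "sym_diff (carrier K - A) (g <# (carrier K - A)) = sym_diff A (g <# A)"
        using that A l_coset_eq_preimage[of g "carrier K - A"] l_coset_eq_preimage[of g A] by auto
      then show ?thesis by (simp add: translate_dist_def)
    qed
    then show ?case
      using Compl(2)[OF Compl(3)] by (metis openin_subset subsetD topspace)
  next
    case (Union A)
    have s: "sets (borel_of T) = sigma_sets (carrier K) {U. openin T U}" by fact
    have A: "\<And>i. A i \<in> sets (borel_of T)" using Union(1) s by simp
    have "(\<lambda>n. measure \<omega> ((\<Union>i. A i) - (\<Union>i<n. A i))) \<longlonglongrightarrow> measure \<omega> (\<Inter>n. (\<Union>i. A i) - (\<Union>i<n. A i))"
      using A by (intro finite_Lim_measure_decseq) (auto simp: decseq_def)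
    also have "(\<Inter>n. (\<Union>i. A i) - (\<Union>i<n. A i)) = {}"
      by auto
    finally have "(\<lambda>n. measure \<omega> ((\<Union>i. A i) - (\<Union>i<n. A i))) \<longlonglongrightarrow> 0" by simp
    then have "\<forall>\<^sub>F n in sequentially. measure \<omega> ((\<Union>i. A i) - (\<Union>i<n. A i)) < \<epsilon> / 4"
      using Union(3) by (intro order_tendstoD(2)) auto
    then obtain n where n: "measure \<omega> ((\<Union>i. A i) - (\<Union>i<n. A i)) < \<epsilon> / 4"
      by (auto simp: eventually_sequentially)
    \<comment> \<open>The remainder counts twice, so its bound \<epsilon> / 4 costs less than
      \<epsilon> / 2; the \<open>n\<close> sets of the partial union share the other half. The
      summand 1 keeps the denominator positive for \<open>n = 0\<close>.\<close>
    let ?\<delta> = "\<epsilon> / (2 * (real n + 1))"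
    have \<delta>: "?\<delta> > 0" using Union(3) by simp
    obtain V where V: "\<And>i. openin T (V i)" "\<And>i. \<one> \<in> V i" "\<And>i g. g \<in> V i \<Longrightarrow> translate_dist (A i) g < ?\<delta>"
      using Union(2)[OF \<delta>] by metis
    \<comment> \<open>The closed range \<open>{..n}\<close> keeps the index set nonempty for
      \<open>n = 0\<close>, and \<open>V 0\<close> confines \<open>?W\<close> to the
      carrier.\<close>
    let ?W = "\<Inter>i\<in>{..n}. V i"
    have "openin T ?W" using V(1) by (intro openin_INT2) auto
    moreover have "translate_dist (\<Union>i. A i) g < \<epsilon>" if "g \<in> ?W" for g
    proof -
      have g: "g \<in> carrier K" using that openin_subset[OF V(1)[of 0]] by auto
      have "(\<Sum>i<n. translate_dist (A i) g) \<le> (\<Sum>i<n. ?\<delta>)"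
        using that by (intro sum_mono less_imp_le V(3)) auto
      also have "\<dots> \<le> \<epsilon> / 2" using Union(3) by (simp add: field_simps)
      finally show ?thesis
        using translate_dist_countable_Union_le[of A g n, OF A g] n by linarith
    qed
    ultimately show ?case using V(2) by blast
  qed
qed

text \<open>Subadditivity and symmetry bound the change from \<open>x\<close> to \<open>x v\<close>
  by the value at \<open>v\<close>, so smallness near 1 gives continuity everywhere.\<close>

lemma continuous_translate_dist:
  assumes A: "A \<in> sets (borel_of T)"
  shows "continuous_map T euclideanreal (translate_dist A)"
  unfolding continuous_map_def
proof (intro conjI allI impI)
  fix W :: "real set" assume "openin euclideanreal W"
  then have W: "open W" by simp
  show "openin T {x \<in> topspace T. translate_dist A x \<in> W}"
  proof (subst openin_subopen, clarify)
    fix x assume x: "x \<in> topspace T" "translate_dist A x \<in> W"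
    then obtain \<epsilon> where \<epsilon>: "\<epsilon> > 0" "\<And>y. dist y (translate_dist A x) < \<epsilon> \<Longrightarrow> y \<in> W"
      using W unfolding open_dist by blast
    obtain V where V: "openin T V" "\<one> \<in> V" "\<And>g. g \<in> V \<Longrightarrow> translate_dist A g < \<epsilon>"
      using translate_dist_small[OF A \<epsilon>(1)] by blast
    have xK: "x \<in> carrier K" using x by simp
    have "translate_dist A (x \<otimes> v) \<in> W" if v: "v \<in> V" for v
    proof (rule \<epsilon>(2))
      have vK: "v \<in> carrier K" using v openin_subset[OF V(1)] by auto
      have "translate_dist A x = translate_dist A ((x \<otimes> v) \<otimes> inv v)"
        using xK vK by (simp add: m_assoc)
      also have "\<dots> \<le> translate_dist A (x \<otimes> v) + translate_dist A v"
        using translate_dist_mult[OF A, of "x \<otimes> v" "inv v"] translate_dist_inv[OF A vK] xK vK by simp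
      finally show "dist (translate_dist A (x \<otimes> v)) (translate_dist A x) < \<epsilon>"
        using translate_dist_mult[OF A xK vK] V(3)[OF v] by (simp add: dist_real_def)
    qed
    moreover have "y \<in> carrier K \<and> (\<exists>v\<in>V. y = x \<otimes> v)" if "y \<in> x <# V" for y
      using that xK openin_subset[OF V(1)] by (auto simp: l_coset_def)
    moreover have "x \<in> x <# V"
      using V(2) xK by (force simp: l_coset_def)
    ultimately show "\<exists>S. openin T S \<and> x \<in> S \<and> S \<subseteq> {x \<in> topspace T. translate_dist A x \<in> W}"
      using openin_l_coset[OF xK V(1)] by (intro exI[of _ "x <# V"]) auto
  qed
qed simp

end

section \<open>Automorphisms and equicontinuity modulo a subgroup\<close>

context compact_group
begin

abbreviation "G \<equiv> Aut K T"

lemma group_G: "group G"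
  by (rule group_Aut[OF compact_metrizable])

interpretation G: group G by (rule group_G)

lemma AutD:
  assumes "f \<in> carrier G"
  shows "f \<in> hom K K" "bij_betw f (carrier K) (carrier K)" "continuous_map T T f"
  using assms by (auto simp: Aut_def auto_def Bij_def)

lemma Aut_closed [intro]: "f \<in> carrier G \<Longrightarrow> x \<in> carrier K \<Longrightarrow> f x \<in> carrier K"
  using AutD(2) by (auto simp: bij_betw_def)

lemma Aut_group_hom: "f \<in> carrier G \<Longrightarrow> group_hom K K f"
  using AutD(1) by (simp add: group_hom_def group_hom_axioms_def group_axioms)

lemma Aut_mult:
  assumes "f \<in> carrier G" "g \<in> carrier G"
  shows "f \<otimes>\<^bsub>G\<^esub> g = compose (carrier K) f g"
  using assms by (auto simp: Aut_def AutoGroup_def BijGroup_def auto_def)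

lemma Aut_mult_apply:
  assumes "f \<in> carrier G" "g \<in> carrier G" "x \<in> carrier K"
  shows "(f \<otimes>\<^bsub>G\<^esub> g) x = f (g x)"
  using assms by (simp add: Aut_mult compose_eq)

lemma Aut_one: "\<one>\<^bsub>G\<^esub> = (\<lambda>x\<in>carrier K. x)"
  by (simp add: Aut_def AutoGroup_def BijGroup_def)

lemma Aut_one_apply: "x \<in> carrier K \<Longrightarrow> \<one>\<^bsub>G\<^esub> x = x"
  by (simp add: Aut_one)

lemma Aut_inv_apply:
  assumes "f \<in> carrier G" "x \<in> carrier K"
  shows "(inv\<^bsub>G\<^esub> f) (f x) = x" "f ((inv\<^bsub>G\<^esub> f) x) = x"
  using assms Aut_mult_apply[of "inv\<^bsub>G\<^esub> f" f x] Aut_mult_apply[of f "inv\<^bsub>G\<^esub> f" x]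
  by (simp_all add: Aut_one_apply)

lemma Aut_mult_image:
  assumes "f \<in> carrier G" "g \<in> carrier G" "A \<subseteq> carrier K"
  shows "(f \<otimes>\<^bsub>G\<^esub> g) ` A = f ` (g ` A)"
  using assms by (force simp: Aut_mult_apply subset_iff image_image intro!: image_cong)

lemma Aut_one_image: "A \<subseteq> carrier K \<Longrightarrow> \<one>\<^bsub>G\<^esub> ` A = A"
  by (force simp: Aut_one_apply subset_iff)

lemma Aut_inv_image:
  assumes "f \<in> carrier G" "A \<subseteq> carrier K"
  shows "(inv\<^bsub>G\<^esub> f) ` (f ` A) = A" "f ` ((inv\<^bsub>G\<^esub> f) ` A) = A"
  using assms Aut_mult_image[of "inv\<^bsub>G\<^esub> f" f A] Aut_mult_image[of f "inv\<^bsub>G\<^esub> f" A]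
  by (simp_all add: Aut_one_image)

lemma Aut_preimage:
  assumes "f \<in> carrier G" "A \<subseteq> carrier K"
  shows "{x \<in> carrier K. f x \<in> A} = (inv\<^bsub>G\<^esub> f) ` A"
proof safe
  fix x assume "x \<in> carrier K" "f x \<in> A"
  then show "x \<in> (inv\<^bsub>G\<^esub> f) ` A"
    using Aut_inv_apply(1)[OF assms(1)] by (metis image_eqI)
next
  fix a assume "a \<in> A"
  then show "(inv\<^bsub>G\<^esub> f) a \<in> carrier K" "f ((inv\<^bsub>G\<^esub> f) a) \<in> A"
    using assms Aut_inv_apply(2)[OF assms(1), of a] by auto
qed

lemma Aut_inj_on: "f \<in> carrier G \<Longrightarrow> A \<subseteq> carrier K \<Longrightarrow> inj_on f A"
  using AutD(2) inj_on_subset unfolding bij_betw_def by blast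

lemma Aut_image_carrier: "f \<in> carrier G \<Longrightarrow> f ` carrier K = carrier K"
  using AutD(2) by (simp add: bij_betw_def)

lemma openin_Aut_image:
  assumes "f \<in> carrier G" "openin T U"
  shows "openin T (f ` U)"
proof -
  have U: "U \<subseteq> carrier K" using openin_subset[OF assms(2)] by simp
  have "{x \<in> carrier K. (inv\<^bsub>G\<^esub> f) x \<in> U} = f ` U"
    using assms(1) U Aut_preimage[of "inv\<^bsub>G\<^esub> f" U] by simp
  then show ?thesis
    using openin_continuous_map_preimage[OF AutD(3)[of "inv\<^bsub>G\<^esub> f"] assms(2)] assms(1) by simp
qed

section \<open>Stabilizers, centralizers and invariance under generated subgroups\<close>

lemma subgroup_stabilizer:
  assumes "V \<subseteq> carrier K"
  shows "subgroup {f \<in> carrier G. f ` V = V} G"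
proof (rule G.subgroupI)
  have "\<one>\<^bsub>G\<^esub> \<in> {f \<in> carrier G. f ` V = V}" using assms by (simp add: Aut_one_image)
  then show "{f \<in> carrier G. f ` V = V} \<noteq> {}" by blast
next
  fix f assume "f \<in> {f \<in> carrier G. f ` V = V}"
  then show "inv\<^bsub>G\<^esub> f \<in> {f \<in> carrier G. f ` V = V}"
    using Aut_inv_image(1)[of f V] assms by auto
next
  fix f g assume "f \<in> {f \<in> carrier G. f ` V = V}" "g \<in> {f \<in> carrier G. f ` V = V}"
  then show "f \<otimes>\<^bsub>G\<^esub> g \<in> {f \<in> carrier G. f ` V = V}"
    using assms by (simp add: Aut_mult_image)
qed auto

lemma invariant_under_generate:
  assumes "S \<subseteq> carrier G" "V \<subseteq> carrier K" "\<forall>f\<in>S. f ` V = V"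
  shows "invariant_under (generate G S) V"
proof -
  have "generate G S \<subseteq> {f \<in> carrier G. f ` V = V}"
    by (intro G.generate_subgroup_incl subgroup_stabilizer) (use assms in blast)+
  then show ?thesis by (auto simp: invariant_under_def)
qed

text \<open>Inclusion for the inverse of \<open>f\<close> is the reverse inclusion for
  \<open>f\<close>.\<close>

lemma invariant_under_subgroupI:
  assumes Z: "subgroup Z G" and V: "V \<subseteq> carrier K" and sub: "\<And>f. f \<in> Z \<Longrightarrow> f ` V \<subseteq> V"
  shows "invariant_under Z V"
  unfolding invariant_under_def
proof
  fix f assume f: "f \<in> Z"
  have fG: "f \<in> carrier G" using subgroup.mem_carrier[OF Z f] .
  have "V = f ` ((inv\<^bsub>G\<^esub> f) ` V)" using Aut_inv_image(2)[OF fG V] by simp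
  also have "\<dots> \<subseteq> f ` V" using sub[OF subgroup.m_inv_closed[OF Z f]] by blast
  finally show "f ` V = V" using sub[OF f] by blast
qed

lemma invariant_under_powers:
  assumes "f \<in> carrier G" "V \<subseteq> carrier K"
  shows "invariant_under (range (\<lambda>n::int. f [^]\<^bsub>G\<^esub> n)) V \<longleftrightarrow> f ` V = V"
proof
  assume "invariant_under (range (\<lambda>n::int. f [^]\<^bsub>G\<^esub> n)) V"
  then have "(f [^]\<^bsub>G\<^esub> (1::int)) ` V = V" unfolding invariant_under_def by blast
  then show "f ` V = V" using assms(1) by (simp add: G.int_pow_1)
next
  assume "f ` V = V"
  then have "f [^]\<^bsub>G\<^esub> n \<in> {f \<in> carrier G. f ` V = V}" for n :: int
    using assms by (intro G.subgroup_int_pow_closed subgroup_stabilizer) auto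
  then show "invariant_under (range (\<lambda>n::int. f [^]\<^bsub>G\<^esub> n)) V"
    by (auto simp: invariant_under_def)
qed

lemma subgroup_centralizer:
  assumes "\<Gamma> \<subseteq> carrier G"
  shows "subgroup (centralizer G \<Gamma>) G"
proof (rule G.subgroupI)
  have "\<one>\<^bsub>G\<^esub> \<in> centralizer G \<Gamma>" using assms by (auto simp: centralizer_def)
  then show "centralizer G \<Gamma> \<noteq> {}" by blast
next
  fix a assume a: "a \<in> centralizer G \<Gamma>"
  then have aG: "a \<in> carrier G" by (simp add: centralizer_def)
  have "inv\<^bsub>G\<^esub> a \<otimes>\<^bsub>G\<^esub> b = b \<otimes>\<^bsub>G\<^esub> inv\<^bsub>G\<^esub> a" if b: "b \<in> \<Gamma>" for b
  proof -
    have bG: "b \<in> carrier G" using b assms by blast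
    have "inv\<^bsub>G\<^esub> a \<otimes>\<^bsub>G\<^esub> b = inv\<^bsub>G\<^esub> a \<otimes>\<^bsub>G\<^esub> (b \<otimes>\<^bsub>G\<^esub> a) \<otimes>\<^bsub>G\<^esub> inv\<^bsub>G\<^esub> a"
      using aG bG by (simp add: G.m_assoc)
    also have "\<dots> = inv\<^bsub>G\<^esub> a \<otimes>\<^bsub>G\<^esub> (a \<otimes>\<^bsub>G\<^esub> b) \<otimes>\<^bsub>G\<^esub> inv\<^bsub>G\<^esub> a"
      using a b by (simp add: centralizer_def)
    also have "\<dots> = b \<otimes>\<^bsub>G\<^esub> inv\<^bsub>G\<^esub> a"
      using aG bG by (simp flip: G.m_assoc)
    finally show ?thesis .
  qed
  then show "inv\<^bsub>G\<^esub> a \<in> centralizer G \<Gamma>" using aG by (simp add: centralizer_def)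
next
  fix a b assume ab: "a \<in> centralizer G \<Gamma>" "b \<in> centralizer G \<Gamma>"
  then have G: "a \<in> carrier G" "b \<in> carrier G" by (auto simp: centralizer_def)
  have "(a \<otimes>\<^bsub>G\<^esub> b) \<otimes>\<^bsub>G\<^esub> c = c \<otimes>\<^bsub>G\<^esub> (a \<otimes>\<^bsub>G\<^esub> b)" if c: "c \<in> \<Gamma>" for c
  proof -
    have cG: "c \<in> carrier G" using c assms by blast
    have "(a \<otimes>\<^bsub>G\<^esub> b) \<otimes>\<^bsub>G\<^esub> c = a \<otimes>\<^bsub>G\<^esub> (c \<otimes>\<^bsub>G\<^esub> b)"
      using ab c G cG by (simp add: G.m_assoc centralizer_def)
    also have "\<dots> = (a \<otimes>\<^bsub>G\<^esub> c) \<otimes>\<^bsub>G\<^esub> b" using G cG by (simp add: G.m_assoc)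
    also have "\<dots> = c \<otimes>\<^bsub>G\<^esub> (a \<otimes>\<^bsub>G\<^esub> b)"
      using ab c G cG by (simp add: G.m_assoc centralizer_def)
    finally show ?thesis .
  qed
  then show "a \<otimes>\<^bsub>G\<^esub> b \<in> centralizer G \<Gamma>" using G by (simp add: centralizer_def)
qed (auto simp: centralizer_def)

text \<open>Phrased inside \<open>K\<close>, so that no quotient group is formed: the open sets
  containing \<open>R\<close> stand for neighbourhoods of the identity coset. Asking
  \<open>V\<close> to contain only \<one> instead of \<open>R\<close> makes the notion visibly
  monotone in \<open>R\<close>; for an \<open>f\<close>-invariant closed subgroup \<open>R\<close>,
  multiplying by \<open>R\<close> recovers the stronger form.\<close>

definition equicontinuous_mod :: "('a \<Rightarrow> 'a) \<Rightarrow> 'a set \<Rightarrow> bool" where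
  "equicontinuous_mod f R \<longleftrightarrow>
    (\<forall>U. openin T U \<and> R \<subseteq> U \<longrightarrow> (\<exists>V. openin T V \<and> \<one> \<in> V \<and> V \<subseteq> U \<and> f ` V = V))"

lemma equicontinuous_modE:
  assumes "equicontinuous_mod f R" "openin T U" "R \<subseteq> U"
  obtains V where "openin T V" "\<one> \<in> V" "V \<subseteq> U" "f ` V = V"
proof -
  have "\<exists>V. openin T V \<and> \<one> \<in> V \<and> V \<subseteq> U \<and> f ` V = V"
    using assms by (simp add: equicontinuous_mod_def)
  then show thesis by (elim exE conjE) (rule that)
qed

lemma equicontinuous_mod_mono:
  "equicontinuous_mod f R \<Longrightarrow> R \<subseteq> R' \<Longrightarrow> equicontinuous_mod f R'"
  unfolding equicontinuous_mod_def by (meson order_trans)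

text \<open>Choose \<open>V\<close> inside a set \<open>U'\<close> with \<open>U' R\<close> in
  \<open>U\<close>; then \<open>V R\<close> contains \<open>R\<close>, stays in \<open>U\<close>,
  and is invariant because \<open>f\<close> preserves both factors.\<close>

lemma equicontinuous_mod_nbhd:
  assumes f: "f \<in> carrier G" "f ` R = R" and R: "subgroup R K" "closedin T R"
    and e: "equicontinuous_mod f R" and U: "openin T U" "R \<subseteq> U"
  obtains V where "openin T V" "R \<subseteq> V" "V \<subseteq> U" "f ` V = V"
proof -
  interpret R: subgroup R K by fact
  obtain U' where U': "openin T U'" "R \<subseteq> U'" "U' <#> R \<subseteq> U"
    by (rule saturated_open_subset[OF R U])
  obtain V where V: "openin T V" "\<one> \<in> V" "V \<subseteq> U'" "f ` V = V"
    by (rule equicontinuous_modE[OF e U'(1,2)])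
  have VK: "V \<subseteq> carrier K" using openin_subset[OF V(1)] by simp
  show thesis
  proof
    show "openin T (V <#> R)" using V(1) R.subset by (rule openin_set_mult)
    show "R \<subseteq> V <#> R"
      using V(2) by (force simp: in_set_mult)
    show "V <#> R \<subseteq> U" using mono_set_mult[OF V(3) order_refl] U'(3) by blast
    show "f ` (V <#> R) = V <#> R"
      using set_mult_hom[OF AutD(1)[OF f(1)] VK R.subset] V(4) f(2) by simp
  qed
qed

text \<open>The orbit of a neighbourhood invariant under the earlier automorphisms stays inside a
  neighbourhood that is invariant under the new one.\<close>

lemma equicontinuous_mod_common_nbhd:
  assumes "finite S" and S: "S \<subseteq> carrier G" "\<And>f g. f \<in> S \<Longrightarrow> g \<in> S \<Longrightarrow> f \<otimes>\<^bsub>G\<^esub> g = g \<otimes>\<^bsub>G\<^esub> f"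
    "\<And>f. f \<in> S \<Longrightarrow> f ` R = R" "\<And>f. f \<in> S \<Longrightarrow> equicontinuous_mod f R"
    and R: "subgroup R K" "closedin T R" and U: "openin T U" "R \<subseteq> U"
  shows "\<exists>V. openin T V \<and> R \<subseteq> V \<and> V \<subseteq> U \<and> (\<forall>f\<in>S. f ` V = V)"
  using assms(1) S U
proof (induction S arbitrary: U)
  case empty
  then show ?case by blast
next
  case (insert f S)
  have f: "f \<in> carrier G" using insert.prems(1) by blast
  obtain V where V: "openin T V" "R \<subseteq> V" "V \<subseteq> U" "f ` V = V"
    using equicontinuous_mod_nbhd[OF f _ R _ insert.prems(5,6)] insert.prems(3,4) by blast
  have "\<exists>W. openin T W \<and> R \<subseteq> W \<and> W \<subseteq> V \<and> (\<forall>g\<in>S. g ` W = W)"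
    using insert.prems(1-4) V(1,2) by (intro insert.IH) blast+
  then obtain W where W: "openin T W" "R \<subseteq> W" "W \<subseteq> V" "\<forall>g\<in>S. g ` W = W" by blast
  have WK: "W \<subseteq> carrier K" using openin_subset[OF W(1)] by simp
  have VK: "V \<subseteq> carrier K" using openin_subset[OF V(1)] by simp
  define X where "X = (\<Union>n::int. (f [^]\<^bsub>G\<^esub> n) ` W)"
  have fn: "f [^]\<^bsub>G\<^esub> n \<in> carrier G" for n :: int using f by (rule G.int_pow_closed)
  have "openin T X"
    using openin_Aut_image[OF fn W(1)] by (auto simp: X_def)
  moreover have "R \<subseteq> X"
  proof -
    have "(f [^]\<^bsub>G\<^esub> (0::int)) ` W = W" using WK by (simp add: Aut_one_image)
    then show ?thesis unfolding X_def using W(2) by blast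
  qed
  moreover have "X \<subseteq> U"
  proof -
    have "invariant_under (range (\<lambda>n::int. f [^]\<^bsub>G\<^esub> n)) V"
      using invariant_under_powers[OF f VK] V(4) by simp
    then have "(f [^]\<^bsub>G\<^esub> n) ` V = V" for n :: int
      unfolding invariant_under_def by blast
    then show ?thesis unfolding X_def using V(3) W(3) by blast
  qed
  moreover have "f ` X = X"
  proof -
    have eq: "f ` (f [^]\<^bsub>G\<^esub> n) ` W = (f [^]\<^bsub>G\<^esub> (1 + n)) ` W" for n :: int
      using Aut_mult_image[OF f fn WK, of n] f by (simp add: G.int_pow_mult G.int_pow_1)
    have "f ` X = (\<Union>n::int. (f [^]\<^bsub>G\<^esub> (1 + n)) ` W)"
      by (simp only: X_def image_UN eq)
    also have "\<dots> = (\<Union>m\<in>range (\<lambda>n::int. 1 + n). (f [^]\<^bsub>G\<^esub> m) ` W)"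
      by blast
    also have "range (\<lambda>n::int. 1 + n) = UNIV"
      by (metis surj_plus)
    finally show ?thesis by (simp add: X_def)
  qed
  moreover have "g ` X = X" if g: "g \<in> S" for g
  proof -
    have gG: "g \<in> carrier G" using g insert.prems(1) by blast
    have "f \<in> centralizer G {g}"
      using f g insert.prems(2) by (auto simp: centralizer_def)
    then have "f [^]\<^bsub>G\<^esub> n \<in> centralizer G {g}" for n :: int
      using gG by (intro G.subgroup_int_pow_closed subgroup_centralizer) auto
    then have "g \<otimes>\<^bsub>G\<^esub> (f [^]\<^bsub>G\<^esub> n) = (f [^]\<^bsub>G\<^esub> n) \<otimes>\<^bsub>G\<^esub> g" for n :: int
      by (simp add: centralizer_def)
    then have "g ` (f [^]\<^bsub>G\<^esub> n) ` W = (f [^]\<^bsub>G\<^esub> n) ` (g ` W)" for n :: int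
      using Aut_mult_image[OF gG fn WK, of n] Aut_mult_image[OF fn gG WK, of n] by simp
    then show ?thesis using W(4) g by (simp add: X_def image_UN)
  qed
  ultimately show ?case by (intro exI[of _ X]) simp
qed

text \<open>If \<open>f^k\<close> preserves \<open>V\<close>, then \<open>f\<close> permutes the
  sets \<open>f^j V\<close> with \<open>j < k\<close> cyclically, so their union is invariant. The
  set \<open>?U'\<close> is chosen so that all of them stay in \<open>U\<close>.\<close>

lemma equicontinuous_mod_root:
  assumes f: "f \<in> carrier G" "f ` R = R" and R: "R \<subseteq> carrier K" and "k > 0"
    and e: "equicontinuous_mod (f [^]\<^bsub>G\<^esub> (k::nat)) R"
  shows "equicontinuous_mod f R"
  unfolding equicontinuous_mod_def
proof (intro allI impI)
  fix U assume U: "openin T U \<and> R \<subseteq> U"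
  have fj: "f [^]\<^bsub>G\<^esub> j \<in> carrier G" for j :: nat using f(1) by simp
  let ?U' = "\<Inter>j\<in>{..k}. {x \<in> carrier K. (f [^]\<^bsub>G\<^esub> j) x \<in> U}"
  have "openin T {x \<in> carrier K. (f [^]\<^bsub>G\<^esub> j) x \<in> U}" for j :: nat
    using openin_continuous_map_preimage[OF AutD(3)[OF fj] conjunct1[OF U]] by simp
  then have "openin T ?U'" by (intro openin_INT2) auto
  moreover have "R \<subseteq> ?U'"
  proof -
    have "(f [^]\<^bsub>G\<^esub> j) ` R = R" for j :: nat
      using G.subgroup_int_pow_closed[OF subgroup_stabilizer[OF R], of f "int j"] f
      by (simp add: int_pow_int)
    then show ?thesis using U R by blast
  qed
  ultimately obtain V where V: "openin T V" "\<one> \<in> V" "V \<subseteq> ?U'" "(f [^]\<^bsub>G\<^esub> k) ` V = V"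
    by (rule equicontinuous_modE[OF e])
  have VK: "V \<subseteq> carrier K" using openin_subset[OF V(1)] by simp
  have V0: "(f [^]\<^bsub>G\<^esub> (0::nat)) ` V = V" using VK by (simp add: Aut_one_image)
  let ?W = "\<Union>j\<in>{..<k}. (f [^]\<^bsub>G\<^esub> j) ` V"
  have "openin T ?W" using openin_Aut_image[OF fj V(1)] by auto
  moreover have "\<one> \<in> ?W"
    using V(2) V0 \<open>k > 0\<close> by blast
  moreover have "?W \<subseteq> U" using V(3) by auto
  moreover have "f ` ?W = ?W"
  proof -
    have eq: "f ` (f [^]\<^bsub>G\<^esub> j) ` V = (f [^]\<^bsub>G\<^esub> Suc j) ` V" for j :: nat
      using Aut_mult_image[OF f(1) fj VK, of j] f(1) by (simp only: G.nat_pow_Suc2)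
    have "f ` ?W = (\<Union>j\<in>{..<k}. (f [^]\<^bsub>G\<^esub> Suc j) ` V)"
      by (simp only: image_UN eq)
    also have "\<dots> = ?W"
    proof (intro equalityI UN_least)
      fix j assume j: "j \<in> {..<k}"
      show "(f [^]\<^bsub>G\<^esub> Suc j) ` V \<subseteq> ?W"
      proof (cases "Suc j = k")
        case True
        then have "(f [^]\<^bsub>G\<^esub> Suc j) ` V = (f [^]\<^bsub>G\<^esub> (0::nat)) ` V"
          using V(4) V0 by simp
        moreover have "(f [^]\<^bsub>G\<^esub> (0::nat)) ` V \<subseteq> ?W" using \<open>k > 0\<close> by (intro UN_upper) simp
        ultimately show ?thesis by simp
      next
        case False
        then show ?thesis using j by (intro UN_upper) simp
      qed
    next
      fix j assume j: "j \<in> {..<k}"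
      \<comment> \<open>The cyclic predecessor of \<open>j\<close> modulo \<open>k\<close>; for
        \<open>j = 0\<close> the wrap-around uses that \<open>f^k\<close> preserves
        \<open>V\<close>.\<close>
      define i where "i = (if j = 0 then k - 1 else j - 1)"
      have "(f [^]\<^bsub>G\<^esub> j) ` V = (f [^]\<^bsub>G\<^esub> Suc i) ` V"
        using V(4) V0 j by (cases j) (simp_all add: i_def)
      moreover have "i \<in> {..<k}" using j by (auto simp: i_def)
      ultimately show "(f [^]\<^bsub>G\<^esub> j) ` V \<subseteq> (\<Union>j\<in>{..<k}. (f [^]\<^bsub>G\<^esub> Suc j) ` V)"
        by (metis (no_types, lifting) UN_upper)
    qed
    finally show ?thesis .
  qed
  ultimately show "\<exists>V. openin T V \<and> \<one> \<in> V \<and> V \<subseteq> U \<and> f ` V = V"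
    by (intro exI[of _ ?W] conjI)
qed

text \<open>As \<open>P R = K\<close>, the group \<open>K / R\<close> is
  \<open>P / (P \<inter> R)\<close>, a quotient of \<open>P / (P \<inter> L)\<close>, which in turn
  embeds in \<open>K / L\<close>. Equicontinuity restricts to the subgroup \<open>P\<close> and
  descends to its quotient.\<close>

lemma equicontinuous_mod_transfer:
  assumes f: "f \<in> carrier G" "f ` P = P" "f ` R = R"
    and P: "subgroup P K" "closedin T P" and R: "subgroup R K" "closedin T R"
    and L: "P \<inter> L \<subseteq> R" and PR: "P <#> R = carrier K" and LK: "L \<subseteq> carrier K"
    and e: "equicontinuous_mod f L"
  shows "equicontinuous_mod f R"
  unfolding equicontinuous_mod_def
proof (intro allI impI)
  interpret P: subgroup P K by fact
  interpret R: subgroup R K by fact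
  fix U assume U: "openin T U \<and> R \<subseteq> U"
  obtain U' where U': "openin T U'" "R \<subseteq> U'" "U' <#> R \<subseteq> U"
    using saturated_open_subset[OF R] U by metis
  \<comment> \<open>This open set is designed so that any \<open>V\<close> inside it satisfies
    \<open>P \<inter> V \<subseteq> U'\<close>; it contains \<open>L\<close> because
    \<open>P \<inter> L \<subseteq> R \<subseteq> U'\<close>.\<close>
  have "openin T (carrier K - (P - U'))"
    using P(2) U'(1) by (metis closedin_diff openin_diff openin_topspace topspace)
  moreover have "L \<subseteq> carrier K - (P - U')" using L LK U'(2) by blast
  ultimately obtain V where V: "openin T V" "\<one> \<in> V" "V \<subseteq> carrier K - (P - U')" "f ` V = V"
    by (rule equicontinuous_modE[OF e])
  have VK: "V \<subseteq> carrier K" using openin_subset[OF V(1)] by simp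
  let ?W = "(P \<inter> V) <#> R"
  let ?Q = "P - (V <#> (P \<inter> R))"
  \<comment> \<open>Openness of \<open>?W\<close> is not immediate, since
    \<open>P \<inter> V\<close> is open only relative to \<open>P\<close>. Its complement is a
    product of two closed sets: two decompositions \<open>p r = p' r'\<close> differ by an element
    of \<open>P \<inter> R\<close>, which \<open>?Q\<close> takes into account.\<close>
  have "?W = carrier K - (?Q <#> R)"
  proof safe
    fix x assume "x \<in> ?W"
    then obtain p r where x: "x = p \<otimes> r" "p \<in> P" "p \<in> V" "r \<in> R" by (auto simp: in_set_mult)
    then show "x \<in> carrier K" by auto
    assume "x \<in> ?Q <#> R"
    then obtain p' r' where x': "x = p' \<otimes> r'" "p' \<in> P" "p' \<notin> V <#> (P \<inter> R)" "r' \<in> R"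
      by (auto simp: in_set_mult)
    have "p' = p \<otimes> (r \<otimes> inv r')"
      using x x' by (metis P.mem_carrier R.m_closed R.m_inv_closed R.mem_carrier inv_solve_right m_assoc m_closed)
    moreover from this have "r \<otimes> inv r' = inv p \<otimes> p'"
      using x x' by (metis P.mem_carrier R.m_closed R.m_inv_closed R.mem_carrier inv_solve_left)
    then have "r \<otimes> inv r' \<in> P" using x(2) x'(2) by simp
    moreover have "r \<otimes> inv r' \<in> R" using x(4) x'(4) by simp
    ultimately show False using x(3) x'(3) by (auto simp: in_set_mult)
  next
    fix x assume x: "x \<in> carrier K" "x \<notin> ?Q <#> R"
    then obtain p r where pr: "x = p \<otimes> r" "p \<in> P" "r \<in> R" using PR by (metis in_set_mult)
    then have "p \<in> V <#> (P \<inter> R)" using x(2) by (auto simp: in_set_mult)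
    then obtain v s where vs: "p = v \<otimes> s" "v \<in> V" "s \<in> P" "s \<in> R" by (auto simp: in_set_mult)
    have "v = p \<otimes> inv s"
      using vs VK by (metis P.mem_carrier inv_solve_right pr(2) subsetD)
    then have "v \<in> P" using pr(2) vs(3) by simp
    moreover have "x = v \<otimes> (s \<otimes> r)"
      using pr vs VK by (auto simp: m_assoc subset_iff)
    ultimately show "x \<in> ?W" using vs pr(3) by (auto simp: in_set_mult)
  qed
  moreover have "closedin T (?Q <#> R)"
    using P(2) R(2) V(1) P.subset
    by (intro closedin_set_mult closedin_diff openin_set_mult) auto
  ultimately have "openin T ?W"
    by (metis openin_diff openin_topspace topspace)
  moreover have "\<one> \<in> ?W"
    using V(2) by (metis IntI P.one_closed R.one_closed in_set_mult l_one one_closed)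
  moreover have "?W \<subseteq> U"
  proof -
    have "P \<inter> V \<subseteq> U'" using V(3) by blast
    then have "?W \<subseteq> U' <#> R" by (intro mono_set_mult) auto
    then show ?thesis using U'(3) by (rule order_trans)
  qed
  moreover have "f ` ?W = ?W"
  proof -
    have "f ` (P \<inter> V) = P \<inter> V"
      using inj_on_image_Int[OF Aut_inj_on[OF f(1) order_refl] P.subset VK] f(2) V(4) by simp
    then show ?thesis
      using set_mult_hom[OF AutD(1)[OF f(1)] _ R.subset, of "P \<inter> V"] VK f(3) by (simp add: le_infI2)
  qed
  ultimately show "\<exists>V. openin T V \<and> \<one> \<in> V \<and> V \<subseteq> U \<and> f ` V = V"
    by (intro exI[of _ ?W] conjI)
qed

end

section \<open>Ergodicity and equicontinuous quotients\<close>

context compact_group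
begin

interpretation G: group G by (rule group_G)

lemma equicontinuous_mod_generate:
  assumes S: "finite S" "S \<subseteq> carrier G" "\<And>f g. f \<in> S \<Longrightarrow> g \<in> S \<Longrightarrow> f \<otimes>\<^bsub>G\<^esub> g = g \<otimes>\<^bsub>G\<^esub> f"
    "\<And>f. f \<in> S \<Longrightarrow> f ` R = R" "\<And>f. f \<in> S \<Longrightarrow> equicontinuous_mod f R"
    and R: "subgroup R K" "closedin T R" and h: "h \<in> generate G S"
  shows "equicontinuous_mod h R"
  unfolding equicontinuous_mod_def
proof (intro allI impI)
  fix U assume U: "openin T U \<and> R \<subseteq> U"
  have "\<exists>V. openin T V \<and> R \<subseteq> V \<and> V \<subseteq> U \<and> (\<forall>f\<in>S. f ` V = V)"
    using U by (intro equicontinuous_mod_common_nbhd S R) auto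
  then obtain V where V: "openin T V" "R \<subseteq> V" "V \<subseteq> U" "\<forall>f\<in>S. f ` V = V" by (elim exE conjE) (rule that)
  have VK: "V \<subseteq> carrier K" using openin_subset[OF V(1)] by simp
  have "h ` V = V"
    using invariant_under_generate[OF S(2) VK V(4)] h by (simp add: invariant_under_def)
  moreover have "\<one> \<in> V" using V(2) subgroup.one_closed[OF R(1)] by (rule subsetD)
  ultimately show "\<exists>V. openin T V \<and> \<one> \<in> V \<and> V \<subseteq> U \<and> h ` V = V"
    using V(1,3) by (intro exI[of _ V]) simp
qed

end

context haar_group
begin

interpretation G: group G by (rule group_G)

text \<open>If some \<open>x\<close> lay outside \<open>R\<close>, separate it from \<open>R\<close>
  by disjoint open sets. A common invariant neighbourhood of \<open>R\<close> in the first has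
  positive measure, and the second prevents it from having full measure.\<close>

lemma ergodic_generate_imp_no_equicontinuous_quotient:
  assumes S: "finite S" "S \<subseteq> carrier G" "\<And>f g. f \<in> S \<Longrightarrow> g \<in> S \<Longrightarrow> f \<otimes>\<^bsub>G\<^esub> g = g \<otimes>\<^bsub>G\<^esub> f"
    "\<And>f. f \<in> S \<Longrightarrow> f ` R = R" "\<And>f. f \<in> S \<Longrightarrow> equicontinuous_mod f R"
    and R: "subgroup R K" "closedin T R" and erg: "ergodic T \<omega> (generate G S)"
  shows "R = carrier K"
proof (rule ccontr)
  assume "R \<noteq> carrier K"
  then obtain x where x: "x \<in> carrier K" "x \<notin> R"
    using subgroup.subset[OF R(1)] by blast
  have "closedin T {x}" using x(1) Hausdorff by (simp add: closedin_Hausdorff_sing_eq)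
  moreover have "disjnt R {x}" using x(2) by (simp add: disjnt_def)
  ultimately obtain U W where UW: "openin T U" "openin T W" "R \<subseteq> U" "{x} \<subseteq> W" "disjnt U W"
    using metrizable_imp_normal_space[OF metrizable] R(2) unfolding normal_space_def by metis
  have "\<exists>V. openin T V \<and> R \<subseteq> V \<and> V \<subseteq> U \<and> (\<forall>f\<in>S. f ` V = V)"
    by (intro equicontinuous_mod_common_nbhd S R UW)
  then obtain V where V: "openin T V" "R \<subseteq> V" "V \<subseteq> U" "\<forall>f\<in>S. f ` V = V" by (elim exE conjE) (rule that)
  have VK: "V \<subseteq> carrier K" using openin_subset[OF V(1)] by simp
  have "measure \<omega> V \<in> {0, 1}"
    using erg invariant_under_generate[OF S(2) VK V(4)] V(1) unfolding ergodic_def by blast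
  moreover have "measure \<omega> V > 0"
    using V(1,2) subgroup.one_closed[OF R(1)] by (intro measure_open_pos) auto
  moreover have "measure \<omega> W > 0"
    using UW by (intro measure_open_pos) auto
  moreover have "measure \<omega> V + measure \<omega> W = measure \<omega> (V \<union> W)"
    using V UW by (intro finite_measure_Union[symmetric]) (auto simp: disjnt_def)
  moreover have "measure \<omega> (V \<union> W) \<le> 1"
    using bounded_measure[of "V \<union> W"] measure_carrier by simp
  ultimately show False by auto
qed

text \<open>By left invariance this is the displacement of \<open>h^-1 A\<close> under
  \<open>x\<close>. That set need not be \<open>f\<close>-invariant when \<open>A\<close> is, so
  \<open>h\<close> ranges over all of \<open>K\<close>: conjugations and automorphisms fixing
  \<open>A\<close> then merely permute the family, and its common kernel is normal.\<close>

definition conjugate_dist :: "'a set \<Rightarrow> 'a \<Rightarrow> 'a \<Rightarrow> real" where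
  "conjugate_dist A h x = translate_dist A (h \<otimes> x \<otimes> inv h)"

lemma conjugate_dist_Aut:
  assumes g: "g \<in> carrier G" and A: "A \<in> sets (borel_of T)" and hx: "h \<in> carrier K" "x \<in> carrier K"
  shows "conjugate_dist A h (g x) = conjugate_dist ((inv\<^bsub>G\<^esub> g) ` A) ((inv\<^bsub>G\<^esub> g) h) x"
proof -
  interpret group_hom K K g using g by (rule Aut_group_hom)
  let ?h = "(inv\<^bsub>G\<^esub> g) h"
  have h: "?h \<in> carrier K" "g ?h = h"
    using Aut_inv_apply[OF g hx(1)] g hx(1) by auto
  have "g (?h \<otimes> x \<otimes> inv ?h) = h \<otimes> g x \<otimes> inv h"
    using h hx by simp
  then have "conjugate_dist A h (g x) = translate_dist {x \<in> carrier K. g x \<in> A} (?h \<otimes> x \<otimes> inv ?h)"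
    using translate_dist_automorphism[OF AutD[OF g] A, of "?h \<otimes> x \<otimes> inv ?h"] h hx
    by (simp add: conjugate_dist_def)
  then show ?thesis
    using Aut_preimage[OF g borel_subset[OF A]] by (simp add: conjugate_dist_def)
qed

lemma Aut_inv_image_borel:
  assumes "g \<in> carrier G" "A \<in> sets (borel_of T)"
  shows "(inv\<^bsub>G\<^esub> g) ` A \<in> sets (borel_of T)"
  using measurable_sets[OF measurable_borel_of_continuous_map[OF AutD(3)[OF assms(1)]] assms(2)]
    Aut_preimage[OF assms(1) borel_subset[OF assms(2)]]
  by (simp add: vimage_def Int_def conj_commute)

lemma conjugate_dist_mult:
  assumes "A \<in> sets (borel_of T)" "h \<in> carrier K" "x \<in> carrier K" "y \<in> carrier K"
  shows "conjugate_dist A h (x \<otimes> y) \<le> conjugate_dist A h x + conjugate_dist A h y"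
proof -
  have "inv h \<otimes> (h \<otimes> (y \<otimes> inv h)) = y \<otimes> inv h"
    using assms(2-4) by (simp flip: m_assoc)
  then have "(h \<otimes> x \<otimes> inv h) \<otimes> (h \<otimes> y \<otimes> inv h) = h \<otimes> (x \<otimes> y) \<otimes> inv h"
    using assms(2-4) by (simp add: m_assoc)
  then show ?thesis
    using translate_dist_mult[OF assms(1), of "h \<otimes> x \<otimes> inv h" "h \<otimes> y \<otimes> inv h"] assms(2-4)
    by (simp add: conjugate_dist_def)
qed

lemma conjugate_dist_inv:
  assumes "A \<in> sets (borel_of T)" "h \<in> carrier K" "x \<in> carrier K"
  shows "conjugate_dist A h (inv x) = conjugate_dist A h x"
proof -
  have "inv (h \<otimes> x \<otimes> inv h) = h \<otimes> inv x \<otimes> inv h"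
    using assms(2,3) by (simp add: inv_mult_group m_assoc)
  then show ?thesis
    using translate_dist_inv[OF assms(1), of "h \<otimes> x \<otimes> inv h"] assms(2,3)
    by (simp add: conjugate_dist_def)
qed

lemma conjugate_dist_one:
  "A \<in> sets (borel_of T) \<Longrightarrow> h \<in> carrier K \<Longrightarrow> conjugate_dist A h \<one> = 0"
  by (simp add: conjugate_dist_def translate_dist_one)

lemma conjugate_dist_nonneg: "conjugate_dist A h x \<ge> 0"
  by (simp add: conjugate_dist_def translate_dist_nonneg)

lemma conjugate_dist_conjugate:
  assumes "h \<in> carrier K" "x \<in> carrier K" "y \<in> carrier K"
  shows "conjugate_dist A h (y \<otimes> x \<otimes> inv y) = conjugate_dist A (h \<otimes> y) x"
  using assms by (simp add: conjugate_dist_def inv_mult_group m_assoc)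

lemma continuous_conjugate_dist:
  assumes "A \<in> sets (borel_of T)"
  shows "continuous_map (prod_topology T T) euclideanreal (\<lambda>z. conjugate_dist A (fst z) (snd z))"
proof -
  have "continuous_map (prod_topology T T) T (\<lambda>z. fst z \<otimes> snd z \<otimes> inv (fst z))"
    by (intro continuous_map_mult continuous_map_inv continuous_map_fst continuous_map_snd)
  from continuous_map_compose[OF this continuous_translate_dist[OF assms]]
  show ?thesis by (simp add: o_def conjugate_dist_def)
qed

lemma continuous_conjugate_dist_right:
  assumes "A \<in> sets (borel_of T)" "h \<in> carrier K"
  shows "continuous_map T euclideanreal (conjugate_dist A h)"
proof -
  have "continuous_map T T (\<lambda>x. h \<otimes> x \<otimes> inv h)"
    using assms(2) by (intro continuous_map_mult) auto
  from continuous_map_compose[OF this continuous_translate_dist[OF assms(1)]]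
  show ?thesis by (simp add: o_def conjugate_dist_def[abs_def])
qed

text \<open>For Borel \<open>A\<close>, the open ball about 1 for the maximum of these pseudonorms
  over \<open>h\<close>, attained because \<open>K\<close> is compact.\<close>

definition conjugate_ball :: "'a set \<Rightarrow> real \<Rightarrow> 'a set" where
  "conjugate_ball A \<epsilon> = {x \<in> carrier K. \<forall>h\<in>carrier K. conjugate_dist A h x < \<epsilon>}"

text \<open>An intersection over infinitely many \<open>h\<close> is not open in general. Here the
  complement is the projection along a compact factor of a set that is closed by joint
  continuity.\<close>

lemma openin_conjugate_ball:
  assumes "A \<in> sets (borel_of T)"
  shows "openin T (conjugate_ball A \<epsilon>)"
proof -
  let ?C = "{z \<in> topspace (prod_topology T T). conjugate_dist A (fst z) (snd z) \<in> {\<epsilon>..}}"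
  have "closedin (prod_topology T T) ?C"
    by (rule closedin_continuous_map_preimage[OF continuous_conjugate_dist[OF assms]]) simp
  then have C: "closedin T (snd ` ?C)"
    using closed_map_snd[OF compact, of T] by (simp add: closed_map_def)
  have eq: "conjugate_ball A \<epsilon> = topspace T - snd ` ?C"
    by (force simp: conjugate_ball_def not_less)
  show ?thesis unfolding eq by (intro openin_diff openin_topspace C)
qed

lemma conjugate_ball_invariant:
  assumes A: "A \<in> sets (borel_of T)"
  shows "invariant_under {f \<in> carrier G. f ` A = A} (conjugate_ball A \<epsilon>)"
proof (rule invariant_under_subgroupI)
  show "subgroup {f \<in> carrier G. f ` A = A} G"
    by (rule subgroup_stabilizer[OF borel_subset[OF A]])
  show "conjugate_ball A \<epsilon> \<subseteq> carrier K" by (auto simp: conjugate_ball_def)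
  fix f assume f: "f \<in> {f \<in> carrier G. f ` A = A}"
  then have fG: "f \<in> carrier G" by simp
  have iA: "(inv\<^bsub>G\<^esub> f) ` A = A"
    using Aut_inv_image(1)[OF fG borel_subset[OF A]] f by simp
  have "conjugate_dist A h (f x) < \<epsilon>" if "x \<in> conjugate_ball A \<epsilon>" "h \<in> carrier K" for x h
    using that conjugate_dist_Aut[OF fG A, of h x] iA Aut_closed[OF G.inv_closed[OF fG], of h]
    by (simp add: conjugate_ball_def)
  then show "f ` conjugate_ball A \<epsilon> \<subseteq> conjugate_ball A \<epsilon>"
    using fG by (auto simp: conjugate_ball_def)
qed

text \<open>Whatever commutes with \<open>f\<close> permutes the \<open>f\<close>-invariant Borel
  sets, so the common kernel \<open>L\<close> over all of them is invariant under the centralizer.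
  It is proper since otherwise every invariant set would be translation invariant up to null
  sets.\<close>

lemma nonergodic_imp_equicontinuous_quotient:
  assumes f: "f \<in> carrier G" and nonerg: "\<not> ergodic_automorphism K T \<omega> f"
  shows "\<exists>L. L \<lhd> K \<and> closedin T L \<and> invariant_under (centralizer G {f}) L \<and> L \<noteq> carrier K
    \<and> equicontinuous_mod f L"
proof -
  define I where "I = {A \<in> sets (borel_of T). f ` A = A}"
  have IB: "A \<in> sets (borel_of T)" if "A \<in> I" for A using that by (simp add: I_def)
  define L where "L = {x \<in> carrier K. \<forall>A\<in>I. \<forall>h\<in>carrier K. conjugate_dist A h x = 0}"
  have L0: "conjugate_dist A h x = 0" if "x \<in> L" "A \<in> I" "h \<in> carrier K" for A h x
    using that by (simp add: L_def)
  have LK: "x \<in> carrier K" if "x \<in> L" for x using that by (simp add: L_def)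
  have LI: "x \<in> L" if "x \<in> carrier K" "\<And>A h. A \<in> I \<Longrightarrow> h \<in> carrier K \<Longrightarrow> conjugate_dist A h x \<le> 0" for x
    using that conjugate_dist_nonneg by (force simp: L_def intro: antisym)
  have "subgroup L K"
  proof (rule subgroupI)
    show "L \<subseteq> carrier K" using LK by blast
    have "\<one> \<in> L" using IB by (intro LI) (auto simp: conjugate_dist_one)
    then show "L \<noteq> {}" by blast
    show "inv x \<in> L" if x: "x \<in> L" for x
      using LK[OF x] IB L0[OF x] by (intro LI) (auto simp: conjugate_dist_inv)
    show "x \<otimes> y \<in> L" if xy: "x \<in> L" "y \<in> L" for x y
    proof (rule LI)
      fix A h assume "A \<in> I" "h \<in> carrier K"
      then show "conjugate_dist A h (x \<otimes> y) \<le> 0"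
        using conjugate_dist_mult[OF IB _ LK[OF xy(1)] LK[OF xy(2)], of A h] L0 xy by simp
    qed (use LK xy in auto)
  qed
  moreover have "y \<otimes> x \<otimes> inv y \<in> L" if "y \<in> carrier K" "x \<in> L" for x y
    using that LK[OF that(2)] L0[OF that(2)] by (intro LI) (auto simp: conjugate_dist_conjugate)
  ultimately have normal: "L \<lhd> K" by (simp add: normal_inv_iff)
  \<comment> \<open>Keeps the intersection that describes \<open>L\<close> from being
    empty-indexed.\<close>
  have "carrier K \<in> I"
    using sets.top[of "borel_of T"] Aut_image_carrier[OF f] by (simp add: I_def)
  have closed: "closedin T L"
  proof -
    have "closedin T {x \<in> carrier K. conjugate_dist A h x = 0}" if "A \<in> I" "h \<in> carrier K" for A h
      using closedin_continuous_map_preimage[OF continuous_conjugate_dist_right[OF IB[OF that(1)] that(2)], of "{0}"]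
      by simp
    moreover have "L = (\<Inter>(A, h)\<in>I \<times> carrier K. {x \<in> topspace T. conjugate_dist A h x \<in> {0}})"
      using \<open>carrier K \<in> I\<close> one_closed by (auto simp: L_def)
    ultimately show ?thesis
      using \<open>carrier K \<in> I\<close> one_closed by (auto intro!: closedin_Inter)
  qed
  have invariant: "invariant_under (centralizer G {f}) L"
  proof (rule invariant_under_subgroupI)
    show sub: "subgroup (centralizer G {f}) G" using f by (intro subgroup_centralizer) simp
    show "L \<subseteq> carrier K" using LK by blast
    fix g assume g: "g \<in> centralizer G {f}"
    then have gG: "g \<in> carrier G" by (simp add: centralizer_def)
    have "(inv\<^bsub>G\<^esub> g) ` A \<in> I" if A: "A \<in> I" for A
    proof -
      have AK: "A \<subseteq> carrier K" using borel_subset[OF IB[OF A]] .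
      have "inv\<^bsub>G\<^esub> g \<otimes>\<^bsub>G\<^esub> f = f \<otimes>\<^bsub>G\<^esub> inv\<^bsub>G\<^esub> g"
        using subgroup.m_inv_closed[OF sub g] by (simp add: centralizer_def)
      then have "f ` (inv\<^bsub>G\<^esub> g) ` A = (inv\<^bsub>G\<^esub> g) ` (f ` A)"
        using Aut_mult_image[of f "inv\<^bsub>G\<^esub> g" A] Aut_mult_image[of "inv\<^bsub>G\<^esub> g" f A] f gG AK by simp
      then show ?thesis
        using A Aut_inv_image_borel[OF gG IB[OF A]] by (simp add: I_def)
    qed
    then have "conjugate_dist A h (g x) = 0" if "x \<in> L" "A \<in> I" "h \<in> carrier K" for x A h
      using that conjugate_dist_Aut[OF gG IB, of A h x] gG LK by (auto intro!: L0)
    then show "g ` L \<subseteq> L" using LK gG by (force intro!: LI)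
  qed
  have proper: "L \<noteq> carrier K"
  proof
    assume L: "L = carrier K"
    obtain A where A: "A \<in> sets (borel_of T)" "f ` A = A" "measure \<omega> A \<notin> {0, 1}"
      using nonerg invariant_under_powers[OF f borel_subset]
      unfolding ergodic_automorphism_def ergodic_def by blast
    have "translate_dist A g = 0" if "g \<in> carrier K" for g
      using L0[of g A \<one>] A(1,2) that by (simp add: L I_def conjugate_dist_def)
    then show False using measure_translation_invariant[OF A(1)] A(3) by blast
  qed
  have "equicontinuous_mod f L"
    unfolding equicontinuous_mod_def
  proof (intro allI impI)
    fix U assume U: "openin T U \<and> L \<subseteq> U"
    \<comment> \<open>Here \<open>p\<close> is a pair of an invariant set and a radius. The open
      sets \<open>O' p\<close> cover \<open>K - U\<close>, because a point outside \<open>L\<close>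
      is detected by some pseudonorm; each misses the ball of the same data, so a finite subcover
      gives finitely many balls meeting inside \<open>U\<close>.\<close>
    define O' where "O' p = {x \<in> carrier K. \<exists>h\<in>carrier K. conjugate_dist (fst p) h x > snd p}" for p
    have O': "openin T (O' p)" if p: "fst p \<in> I" for p
    proof -
      have "openin T {x \<in> carrier K. snd p < conjugate_dist (fst p) h x}" if "h \<in> carrier K" for h
        using openin_continuous_map_preimage[OF continuous_conjugate_dist_right[OF IB[OF p] that], of "{snd p<..}"]
        by simp
      moreover have "O' p = (\<Union>h\<in>carrier K. {x \<in> topspace T. conjugate_dist (fst p) h x \<in> {snd p<..}})"
        by (auto simp: O'_def)
      ultimately show ?thesis by auto
    qed
    have "closedin T (topspace T - U)" using U by blast
    then have "compactin T (carrier K - U)"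
      using closedin_compact_space[OF compact] by simp
    moreover have "carrier K - U \<subseteq> \<Union>(O' ` (I \<times> {0<..}))"
    proof
      fix x assume x: "x \<in> carrier K - U"
      then have "x \<notin> L" using U by blast
      then obtain A h where Ah: "A \<in> I" "h \<in> carrier K" "conjugate_dist A h x > 0"
        using LI[of x] x by force
      then have "x \<in> O' (A, conjugate_dist A h x / 2)"
        using x by (auto simp: O'_def intro!: bexI[of _ h])
      then show "x \<in> \<Union>(O' ` (I \<times> {0<..}))"
        using Ah by (intro UN_I[of "(A, conjugate_dist A h x / 2)"]) auto
    qed
    moreover have "\<forall>W\<in>O' ` (I \<times> {0<..}). openin T W" using O' by auto
    ultimately obtain \<F> where \<F>: "finite \<F>" "\<F> \<subseteq> O' ` (I \<times> {0<..})" "carrier K - U \<subseteq> \<Union>\<F>"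
      unfolding compactin_def by metis
    then obtain P where P: "finite P" "P \<subseteq> I \<times> {0<..}" "carrier K - U \<subseteq> \<Union>(O' ` P)"
      using finite_subset_image[OF \<F>(1,2)] by metis
    \<comment> \<open>The factor \<open>topspace T\<close> covers the case of empty
      \<open>P\<close>, which may occur when \<open>U\<close> is all of \<open>K\<close>.\<close>
    define V where "V = topspace T \<inter> (\<Inter>p\<in>P. conjugate_ball (fst p) (snd p))"
    have ball: "openin T (conjugate_ball (fst p) (snd p))" "f ` conjugate_ball (fst p) (snd p) = conjugate_ball (fst p) (snd p)"
      if "p \<in> P" for p
    proof -
      have p: "fst p \<in> I" using that P(2) by auto
      show "openin T (conjugate_ball (fst p) (snd p))"
        using IB[OF p] by (rule openin_conjugate_ball)
      show "f ` conjugate_ball (fst p) (snd p) = conjugate_ball (fst p) (snd p)"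
        using conjugate_ball_invariant[OF IB[OF p], of "snd p"] p f by (simp add: invariant_under_def I_def)
    qed
    have "openin T V"
      unfolding V_def using openin_INT[OF P(1) ball(1)] by (simp add: Int_commute)
    moreover have "\<one> \<in> V"
      using P(2) IB by (auto simp: V_def conjugate_ball_def conjugate_dist_one)
    moreover have "V \<subseteq> U"
    proof
      fix x assume x: "x \<in> V"
      show "x \<in> U"
      proof (rule ccontr)
        assume "x \<notin> U"
        then obtain p where p: "p \<in> P" "x \<in> O' p" using x P(3) by (auto simp: V_def)
        then have "x \<in> conjugate_ball (fst p) (snd p)" using x by (auto simp: V_def)
        then show False using p(2) by (auto simp: O'_def conjugate_ball_def not_less)
      qed
    qed
    moreover have "f ` V = V"
    proof -
      have "invariant_under (generate G {f}) V"
      proof (rule invariant_under_subgroupI)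
        show "subgroup (generate G {f}) G" using f by (intro G.generate_is_subgroup) simp
        show "V \<subseteq> carrier K" by (simp add: V_def)
        fix g assume g: "g \<in> generate G {f}"
        then have gG: "g \<in> carrier G" using G.generate_in_carrier[of "{f}" g] f by simp
        have g_ball: "g ` conjugate_ball (fst p) (snd p) = conjugate_ball (fst p) (snd p)" if "p \<in> P" for p
          using invariant_under_generate[of "{f}" "conjugate_ball (fst p) (snd p)"] f ball(2)[OF that] g
          by (auto simp: invariant_under_def conjugate_ball_def)
        show "g ` V \<subseteq> V"
        proof clarify
          fix x assume x: "x \<in> V"
          have "g x \<in> conjugate_ball (fst p) (snd p)" if p: "p \<in> P" for p
            using x p imageI[of x "conjugate_ball (fst p) (snd p)" g] unfolding g_ball[OF p] V_def by blast
          then show "g x \<in> V" using x gG by (auto simp: V_def)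
        qed
      qed
      moreover have "f \<in> generate G {f}" by (simp add: generate.incl)
      ultimately show ?thesis by (simp add: invariant_under_def)
    qed
    ultimately show "\<exists>V. openin T V \<and> \<one> \<in> V \<and> V \<subseteq> U \<and> f ` V = V"
      by (intro exI[of _ V]) simp
  qed
  with normal closed invariant proper show ?thesis by (intro exI[of _ L] conjI)
qed

end

section \<open>Commuting automorphisms\<close>

text \<open>Dependent choice turns the chain condition into a minimum condition.\<close>

lemma DCC_minimal:
  assumes DCC: "DCC K T H" and C: "C \<in> \<S>"
    and \<S>: "\<And>C. C \<in> \<S> \<Longrightarrow> subgroup C K \<and> closedin T C \<and> invariant_under H C"
  obtains P where "P \<in> \<S>" "\<And>Q. Q \<in> \<S> \<Longrightarrow> Q \<subseteq> P \<Longrightarrow> Q = P"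
proof -
  have "\<exists>P\<in>\<S>. \<forall>Q\<in>\<S>. Q \<subseteq> P \<longrightarrow> Q = P"
  proof (rule ccontr)
    assume "\<not> ?thesis"
    then have step: "\<forall>P\<in>\<S>. \<exists>Q\<in>\<S>. Q \<subset> P" by blast
    have "\<exists>P. P \<in> \<S>" "\<And>P n::nat. P \<in> \<S> \<Longrightarrow> \<exists>Q. Q \<in> \<S> \<and> Q \<subset> P"
      using C step by blast+
    from dependent_nat_choice[of "\<lambda>_ P. P \<in> \<S>" "\<lambda>_ P Q. Q \<subset> P", OF this]
    obtain F where "\<forall>n::nat. F n \<in> \<S> \<and> F (Suc n) \<subset> F n" by (rule exE)
    then have F: "F n \<in> \<S>" "F (Suc n) \<subset> F n" for n by simp_all
    have "decseq F" using F(2) by (intro decseq_SucI) auto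
    then obtain n where "\<And>i. F n = F (n + i)"
      using DCC \<S>[OF F(1)] unfolding DCC_def by blast
    from this[of 1] show False using F(2)[of n] by simp
  qed
  then show thesis using that by blast
qed

section \<open>Closed factors and the merging of generators of an abelian group\<close>

locale abelian_action = haar_group K T \<omega>
  for K (structure) and T :: "'a topology" and \<omega> :: "'a measure" +
  fixes \<Gamma> :: "('a \<Rightarrow> 'a) set"
  assumes subgroup_\<Gamma>: "subgroup \<Gamma> (Aut K T)"
    and commute: "\<And>f g. f \<in> \<Gamma> \<Longrightarrow> g \<in> \<Gamma> \<Longrightarrow> f \<otimes>\<^bsub>Aut K T\<^esub> g = g \<otimes>\<^bsub>Aut K T\<^esub> f"
begin

interpretation G: group G by (rule group_G)

lemma \<Gamma>_carrier: "\<Gamma> \<subseteq> carrier G"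
  by (rule subgroup.subset[OF subgroup_\<Gamma>])

abbreviation "Z \<equiv> centralizer G \<Gamma>"

lemma \<Gamma>_subset_Z: "\<Gamma> \<subseteq> Z"
  using \<Gamma>_carrier commute by (auto simp: centralizer_def)

text \<open>Invariance under \<open>Z\<close> rather than \<Gamma> puts these subgroups within reach
  of the chain condition; as \<Gamma> is abelian it lies in \<open>Z\<close>, hence acts on
  \<open>K / R\<close>.\<close>

definition closed_factor :: "'a set \<Rightarrow> bool" where
  "closed_factor R \<longleftrightarrow> R \<lhd> K \<and> closedin T R \<and> invariant_under Z R"

lemma closed_factorD:
  assumes "closed_factor R"
  shows "R \<lhd> K" "subgroup R K" "closedin T R" "invariant_under Z R" "R \<subseteq> carrier K"
    "\<And>f. f \<in> \<Gamma> \<Longrightarrow> f ` R = R"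
proof -
  show *: "R \<lhd> K" "closedin T R" "invariant_under Z R"
    using assms by (auto simp: closed_factor_def)
  show s: "subgroup R K" using *(1) by (simp add: normal_inv_iff)
  show "R \<subseteq> carrier K" using subgroup.subset[OF s] .
  show "f ` R = R" if "f \<in> \<Gamma>" for f
    using *(3) \<Gamma>_subset_Z that by (auto simp: invariant_under_def)
qed

lemma closed_factor_Int:
  assumes "closed_factor P" "closed_factor R"
  shows "closed_factor (P \<inter> R)"
proof -
  note P = closed_factorD[OF assms(1)] and R = closed_factorD[OF assms(2)]
  have "f ` (P \<inter> R) = P \<inter> R" if f: "f \<in> Z" for f
  proof -
    have "f \<in> carrier G" using f by (simp add: centralizer_def)
    then show ?thesis
      using inj_on_image_Int[OF Aut_inj_on[OF _ order_refl] P(5) R(5)] P(4) R(4) f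
      by (simp add: invariant_under_def)
  qed
  then show ?thesis
    using normal_subgroup_intersect[OF P(1) R(1)] closedin_Int[OF P(3) R(3)]
    by (simp add: closed_factor_def invariant_under_def)
qed

lemma normal_set_mult:
  assumes "P \<lhd> K" "R \<lhd> K"
  shows "P <#> R \<lhd> K"
proof -
  interpret P: normal P K by fact
  interpret R: normal R K by fact
  have "second_isomorphism_grp P K R"
    by (simp add: second_isomorphism_grp_def second_isomorphism_grp_axioms_def assms R.subgroup_axioms)
  then have "subgroup (P <#> R) K" by (rule second_isomorphism_grp.normal_set_mult_subgroup)
  moreover have "x \<otimes> z \<otimes> inv x \<in> P <#> R" if x: "x \<in> carrier K" and z: "z \<in> P <#> R" for x z
  proof -
    obtain p r where pr: "p \<in> P" "r \<in> R" "z = p \<otimes> r" using z by (auto simp: in_set_mult)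
    have c: "p \<in> carrier K" "r \<in> carrier K" using pr by auto
    have "inv x \<otimes> (x \<otimes> (r \<otimes> inv x)) = r \<otimes> inv x"
      using c x by (simp flip: m_assoc)
    then have "x \<otimes> z \<otimes> inv x = (x \<otimes> p \<otimes> inv x) \<otimes> (x \<otimes> r \<otimes> inv x)"
      using c x by (simp add: pr(3) m_assoc)
    then show ?thesis
      using P.inv_op_closed2[OF x pr(1)] R.inv_op_closed2[OF x pr(2)] unfolding in_set_mult by blast
  qed
  ultimately show ?thesis by (simp add: normal_inv_iff)
qed

lemma closed_factor_set_mult:
  assumes "closed_factor P" "closed_factor R"
  shows "closed_factor (P <#> R)"
proof -
  note P = closed_factorD[OF assms(1)] and R = closed_factorD[OF assms(2)]
  have "f ` (P <#> R) = P <#> R" if f: "f \<in> Z" for f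
  proof -
    have "f \<in> carrier G" using f by (simp add: centralizer_def)
    then show ?thesis
      using set_mult_hom[OF AutD(1) P(5) R(5)] P(4) R(4) f by (simp add: invariant_under_def)
  qed
  then show ?thesis
    using normal_set_mult[OF P(1) R(1)] closedin_set_mult[OF P(3) R(3)]
    by (simp add: closed_factor_def invariant_under_def)
qed

text \<open>The property carried through the induction: it follows from ergodicity of \<Gamma> when
  \<open>H\<close> is a finite generating set, and for \<open>H = {f}\<close> it gives ergodicity of
  \<open>f\<close>.\<close>

definition jointly_ergodic :: "('a \<Rightarrow> 'a) set \<Rightarrow> bool" where
  "jointly_ergodic H \<longleftrightarrow>
    (\<forall>R. closed_factor R \<and> (\<forall>f\<in>H. equicontinuous_mod f R) \<longrightarrow> R = carrier K)"

lemma jointly_ergodicD: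
  assumes "jointly_ergodic H" "closed_factor R" "\<And>f. f \<in> H \<Longrightarrow> equicontinuous_mod f R"
  shows "R = carrier K"
  using assms unfolding jointly_ergodic_def by blast

lemma jointly_ergodic_mono: "jointly_ergodic H \<Longrightarrow> H \<subseteq> H' \<Longrightarrow> jointly_ergodic H'"
  unfolding jointly_ergodic_def by blast

lemma jointly_ergodic_generators:
  assumes "finite S" "S \<subseteq> \<Gamma>" "generate G S = \<Gamma>" "ergodic T \<omega> \<Gamma>"
  shows "jointly_ergodic S"
  unfolding jointly_ergodic_def
proof (intro allI impI)
  fix R assume R: "closed_factor R \<and> (\<forall>f\<in>S. equicontinuous_mod f R)"
  show "R = carrier K"
  proof (rule ergodic_generate_imp_no_equicontinuous_quotient[of S])
    show "S \<subseteq> carrier G" using assms(2) \<Gamma>_carrier by blast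
    show "ergodic T \<omega> (generate G S)" using assms(3,4) by simp
    show "f \<otimes>\<^bsub>G\<^esub> g = g \<otimes>\<^bsub>G\<^esub> f" if "f \<in> S" "g \<in> S" for f g
      using that assms(2) by (intro commute) auto
  qed (use R assms(1,2) closed_factorD in blast)+
qed

text \<open>The quotient obtained from nonergodicity of \<open>f\<close> is invariant under
  everything commuting with \<open>f\<close>, in particular under \<open>Z\<close>, so it is a
  closed factor.\<close>

lemma jointly_ergodic_singleton:
  assumes f: "f \<in> \<Gamma>" and je: "jointly_ergodic {f}"
  shows "ergodic_automorphism K T \<omega> f"
proof (rule ccontr)
  assume n: "\<not> ergodic_automorphism K T \<omega> f"
  have "f \<in> carrier G" using f \<Gamma>_carrier by blast
  from nonergodic_imp_equicontinuous_quotient[OF this n]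
  obtain L where L: "L \<lhd> K" "closedin T L" "invariant_under (centralizer G {f}) L" "L \<noteq> carrier K"
    "equicontinuous_mod f L" by blast
  have "Z \<subseteq> centralizer G {f}" using f by (auto simp: centralizer_def)
  then have "closed_factor L" using L by (auto simp: closed_factor_def invariant_under_def)
  then show False using jointly_ergodicD[OF je] L(4,5) by blast
qed

lemma equicontinuous_mod_closed_factor:
  assumes "closed_factor R" "finite S" "S \<subseteq> \<Gamma>" "\<And>f. f \<in> S \<Longrightarrow> equicontinuous_mod f R" "g \<in> generate G S"
  shows "equicontinuous_mod g R"
proof (rule equicontinuous_mod_generate[of S])
  show "S \<subseteq> carrier G" using assms(3) \<Gamma>_carrier by blast
  show "f \<otimes>\<^bsub>G\<^esub> g = g \<otimes>\<^bsub>G\<^esub> f" if "f \<in> S" "g \<in> S" for f g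
    using that assms(3) by (intro commute) auto
  show "f ` R = R" if "f \<in> S" for f
    using that assms(3) closed_factorD(6)[OF assms(1)] by blast
qed (use assms closed_factorD in auto)

lemma pow_\<Gamma>: "f \<in> \<Gamma> \<Longrightarrow> f [^]\<^bsub>G\<^esub> (n::nat) \<in> \<Gamma>"
  using G.subgroup_int_pow_closed[OF subgroup_\<Gamma>, of f "int n"] by (simp add: int_pow_int)

text \<open>The quotient of the two products is \<open>b^(j-i)\<close>, with positive exponent, so
  passing to the root yields \<open>b\<close>; then \<open>a = (a b^i) b^-i\<close>.\<close>

lemma equicontinuous_mod_two_combinations:
  assumes ab: "a \<in> \<Gamma>" "b \<in> \<Gamma>" and R: "closed_factor R" and "i < (j::nat)"
    and e: "equicontinuous_mod (a \<otimes>\<^bsub>G\<^esub> b [^]\<^bsub>G\<^esub> i) R" "equicontinuous_mod (a \<otimes>\<^bsub>G\<^esub> b [^]\<^bsub>G\<^esub> j) R"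
  shows "equicontinuous_mod a R" "equicontinuous_mod b R"
proof -
  let ?c = "\<lambda>i::nat. a \<otimes>\<^bsub>G\<^esub> b [^]\<^bsub>G\<^esub> i"
  have G: "a \<in> carrier G" "b \<in> carrier G" using ab \<Gamma>_carrier by auto
  have c: "?c i \<in> \<Gamma>" for i
    using ab pow_\<Gamma> subgroup.m_closed[OF subgroup_\<Gamma>] by blast
  have "b [^]\<^bsub>G\<^esub> j = b [^]\<^bsub>G\<^esub> i \<otimes>\<^bsub>G\<^esub> b [^]\<^bsub>G\<^esub> (j - i)"
    using G \<open>i < j\<close> by (simp add: G.nat_pow_mult)
  then have "?c j = ?c i \<otimes>\<^bsub>G\<^esub> b [^]\<^bsub>G\<^esub> (j - i)"
    using G by (simp add: G.m_assoc)
  then have "b [^]\<^bsub>G\<^esub> (j - i) = inv\<^bsub>G\<^esub> (?c i) \<otimes>\<^bsub>G\<^esub> ?c j"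
    using G by (simp add: G.inv_solve_left)
  then have gen: "b [^]\<^bsub>G\<^esub> (j - i) \<in> generate G {?c i, ?c j}"
    by (auto intro: generate.intros)
  have "equicontinuous_mod (b [^]\<^bsub>G\<^esub> (j - i)) R"
  proof (rule equicontinuous_mod_closed_factor[OF R _ _ _ gen])
    show "equicontinuous_mod f R" if "f \<in> {?c i, ?c j}" for f
      using that e by (elim insertE emptyE) simp_all
  qed (use c in simp_all)
  then show b: "equicontinuous_mod b R"
    using \<open>i < j\<close> G(2) ab(2) closed_factorD[OF R] by (intro equicontinuous_mod_root[of b R "j - i"]) auto
  have sub: "subgroup (generate G {?c i, b}) G"
    using G by (intro G.generate_is_subgroup) auto
  have "b [^]\<^bsub>G\<^esub> i \<in> generate G {?c i, b}"
    using G.subgroup_int_pow_closed[OF sub, of b "int i"] by (simp add: int_pow_int generate.incl)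
  then have "?c i \<otimes>\<^bsub>G\<^esub> inv\<^bsub>G\<^esub> (b [^]\<^bsub>G\<^esub> i) \<in> generate G {?c i, b}"
    by (rule subgroup.m_closed[OF sub _ subgroup.m_inv_closed[OF sub], rotated]) (simp add: generate.incl)
  then have gen: "a \<in> generate G {?c i, b}"
    using G by (simp add: G.m_assoc)
  show "equicontinuous_mod a R"
  proof (rule equicontinuous_mod_closed_factor[OF R _ _ _ gen])
    show "equicontinuous_mod f R" if "f \<in> {?c i, b}" for f
      using that e(1) b by (elim insertE emptyE) simp_all
  qed (use c ab in simp_all)
qed

text \<open>If every \<open>a b\<^sup>i\<close> had a proper equicontinuous quotient \<open>K / L i\<close>, let \<open>P\<close> be minimal among
  the closed factors with \<open>P L i = K\<close> for infinitely many \<open>i\<close>.  By minimality \<open>R = (P \<inter> L i) L j\<close>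
  is proper for two such \<open>i \<noteq> j\<close>.  On \<open>K / R\<close> the map \<open>a b\<^sup>j\<close> acts equicontinuously since
  \<open>L j \<subseteq> R\<close>, and so does \<open>a b\<^sup>i\<close> since \<open>K / R\<close> is a quotient of \<open>P / (P \<inter> L i)\<close>; hence \<open>a\<close>
  and \<open>b\<close> do.\<close>

lemma jointly_ergodic_combine:
  assumes DCC: "DCC K T Z" and ab: "a \<in> \<Gamma>" "b \<in> \<Gamma>" and H: "H \<subseteq> \<Gamma>"
    and je: "jointly_ergodic (insert a (insert b H))"
  shows "\<exists>i::nat. i > 0 \<and> jointly_ergodic (insert (a \<otimes>\<^bsub>G\<^esub> b [^]\<^bsub>G\<^esub> i) H)"
proof (rule ccontr)
  let ?c = "\<lambda>i::nat. a \<otimes>\<^bsub>G\<^esub> b [^]\<^bsub>G\<^esub> i"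
  assume "\<not> ?thesis"
  then have "\<forall>i>0. \<exists>L. closed_factor L \<and> (\<forall>f\<in>insert (?c i) H. equicontinuous_mod f L) \<and> L \<noteq> carrier K"
    unfolding jointly_ergodic_def by blast
  then obtain L where L: "\<And>i. i > 0 \<Longrightarrow> closed_factor (L i)" "\<And>i. i > 0 \<Longrightarrow> L i \<noteq> carrier K"
    "\<And>i. i > 0 \<Longrightarrow> equicontinuous_mod (?c i) (L i)"
    "\<And>i f. i > 0 \<Longrightarrow> f \<in> H \<Longrightarrow> equicontinuous_mod f (L i)"
    by (metis insertCI)
  have c: "?c i \<in> \<Gamma>" for i
    using ab pow_\<Gamma> subgroup.m_closed[OF subgroup_\<Gamma>] by blast
  define I where "I P = {i. i > 0 \<and> P <#> L i = carrier K}" for P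
  define \<S> where "\<S> = {P. closed_factor P \<and> infinite (I P)}"
  have "carrier K \<in> \<S>"
  proof -
    have "carrier K \<lhd> K" by (simp add: normal_inv_iff subgroup_self)
    moreover have "closedin T (carrier K)" using closedin_topspace[of T] by simp
    moreover have "invariant_under Z (carrier K)"
      by (auto simp: invariant_under_def centralizer_def Aut_image_carrier)
    moreover have "I (carrier K) = {0<..}"
      using set_mult_carrier_idem closed_factorD(2)[OF L(1)] by (auto simp: I_def)
    ultimately show ?thesis by (simp add: \<S>_def closed_factor_def infinite_Ioi)
  qed
  then obtain P where P: "P \<in> \<S>" and minimal: "\<And>Q. Q \<in> \<S> \<Longrightarrow> Q \<subseteq> P \<Longrightarrow> Q = P"
    by (rule DCC_minimal[OF DCC]) (use closed_factorD in \<open>auto simp: \<S>_def\<close>)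
  have Pf: "closed_factor P" and inf: "infinite (I P)" using P by (auto simp: \<S>_def)
  then obtain i where i: "i \<in> I P" by (metis ex_in_conv finite.emptyI)
  then have i0: "i > 0" and PLi: "P <#> L i = carrier K" by (auto simp: I_def)
  note Li = closed_factorD[OF L(1)[OF i0]]
  let ?Q = "P \<inter> L i"
  have Q: "closed_factor ?Q" using Pf L(1)[OF i0] by (rule closed_factor_Int)
  \<comment> \<open>Equality would put \<open>P\<close> inside \<open>L i\<close>, and
    \<open>P L i = K\<close> would make \<open>L i\<close> all of \<open>K\<close>. So
    \<open>?Q\<close> is strictly smaller than \<open>P\<close>, and minimality leaves only finitely
    many indices in \<open>I ?Q\<close>.\<close>
  have "?Q \<noteq> P"
  proof
    assume "?Q = P"
    then have "P \<subseteq> L i" by blast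
    then have "P <#> L i \<subseteq> L i"
      using subgroup.m_closed[OF Li(2)] by (auto simp: in_set_mult subset_iff)
    then show False using PLi Li(5) L(2)[OF i0] by blast
  qed
  then have "finite (I ?Q)" using minimal[of ?Q] Q by (auto simp: \<S>_def)
  then have "infinite (I P - I ?Q - {i})" using inf by simp
  then obtain j where j: "j \<in> I P" "j \<notin> I ?Q" "j \<noteq> i" by (metis DiffE ex_in_conv finite.emptyI singletonI)
  then have j0: "j > 0" and PLj: "P <#> L j = carrier K" by (auto simp: I_def)
  note Lj = closed_factorD[OF L(1)[OF j0]]
  define R where "R = ?Q <#> L j"
  have R: "closed_factor R" unfolding R_def using Q L(1)[OF j0] by (rule closed_factor_set_mult)
  have QR: "?Q \<subseteq> R"
    unfolding R_def using subgroup.one_closed[OF Lj(2)] closed_factorD(5)[OF Pf]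
    by (force simp: in_set_mult)
  have LR: "L j \<subseteq> R"
    unfolding R_def using subgroup.one_closed[OF closed_factorD(2)[OF Q]] Lj(5)
    by (force simp: in_set_mult)
  have "R \<noteq> carrier K" using j(2) j0 by (simp add: I_def R_def)
  moreover have "equicontinuous_mod f R" if "f \<in> insert a (insert b H)" for f
  proof -
    have ej: "equicontinuous_mod (?c j) R"
      using L(3)[OF j0] LR by (rule equicontinuous_mod_mono)
    have "P <#> R = carrier K"
    proof -
      have "P <#> L j \<subseteq> P <#> R" using LR by (intro mono_set_mult) auto
      then show ?thesis
        using PLj set_mult_closed[OF closed_factorD(5)[OF Pf] closed_factorD(5)[OF R]] by blast
    qed
    then have ei: "equicontinuous_mod (?c i) R"
      using c \<Gamma>_carrier closed_factorD[OF Pf] closed_factorD[OF R] QR Li(5) L(3)[OF i0]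
      by (intro equicontinuous_mod_transfer[of "?c i" P R "L i"]) auto
    have "equicontinuous_mod a R \<and> equicontinuous_mod b R"
    proof (cases "i < j")
      case True
      then show ?thesis using equicontinuous_mod_two_combinations[OF ab R _ ei ej] by blast
    next
      case False
      then show ?thesis using equicontinuous_mod_two_combinations[OF ab R _ ej ei] j(3) by auto
    qed
    \<comment> \<open>The automorphisms not being merged survive because \<open>L j\<close>, modulo
      which they are equicontinuous, lies in \<open>R\<close>.\<close>
    moreover have "equicontinuous_mod f R" if "f \<in> H"
      using L(4)[OF j0 that] LR by (rule equicontinuous_mod_mono)
    ultimately show ?thesis using that by blast
  qed
  ultimately show False using jointly_ergodicD[OF je R] by blast
qed

text \<open>The set \<open>H\<close> is arbitrary so that the last generator can wait there while
  the earlier ones are merged. Their product then enters the next merge with exponent 1, so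
  exponents already found stay unchanged.\<close>

lemma jointly_ergodic_product:
  assumes DCC: "DCC K T Z" and comm: "comm_group (G\<lparr>carrier := \<Gamma>\<rparr>)"
    and H: "H \<subseteq> \<Gamma>" and \<alpha>: "\<alpha> ` {1..n} \<subseteq> \<Gamma>" and je: "jointly_ergodic (\<alpha> ` {1..n} \<union> H)"
  shows "\<exists>i::nat \<Rightarrow> nat. (\<forall>j\<in>{1..n}. i j > 0) \<and>
    jointly_ergodic (insert (\<Otimes>\<^bsub>G\<lparr>carrier := \<Gamma>\<rparr>\<^esub>j\<in>{1..n}. \<alpha> j [^]\<^bsub>G\<^esub> i j) H)"
  using H \<alpha> je
proof (induction n arbitrary: H)
  case 0
  then have "jointly_ergodic H" by simp
  then show ?case
    \<comment> \<open>The empty product is inserted freely, since enlarging the set preserves joint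
      ergodicity.\<close>
    by (intro exI[of _ "\<lambda>_. 1"] conjI jointly_ergodic_mono[OF _ subset_insertI]) simp_all
next
  case (Suc n)
  interpret C: comm_group "G\<lparr>carrier := \<Gamma>\<rparr>" by (rule comm)
  have a: "\<alpha> j \<in> \<Gamma>" if "j \<in> {1..Suc n}" for j using Suc.prems(2) that by blast
  have eq: "\<alpha> ` {1..Suc n} \<union> H = \<alpha> ` {1..n} \<union> insert (\<alpha> (Suc n)) H"
    by (auto simp: atLeastAtMostSuc_conv)
  have "\<alpha> ` {1..n} \<subseteq> \<Gamma>" "insert (\<alpha> (Suc n)) H \<subseteq> \<Gamma>" using a Suc.prems(1) by auto
  then obtain i :: "nat \<Rightarrow> nat" where i: "\<forall>j\<in>{1..n}. i j > 0"
    "jointly_ergodic (insert (\<Otimes>\<^bsub>G\<lparr>carrier := \<Gamma>\<rparr>\<^esub>j\<in>{1..n}. \<alpha> j [^]\<^bsub>G\<^esub> i j) (insert (\<alpha> (Suc n)) H))"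
    using Suc.IH[of "insert (\<alpha> (Suc n)) H"] Suc.prems(3) unfolding eq by blast
  let ?p = "\<Otimes>\<^bsub>G\<lparr>carrier := \<Gamma>\<rparr>\<^esub>j\<in>{1..n}. \<alpha> j [^]\<^bsub>G\<^esub> i j"
  have "?p \<in> \<Gamma>"
    using C.finprod_closed[of "\<lambda>j. \<alpha> j [^]\<^bsub>G\<^esub> i j" "{1..n}"] a pow_\<Gamma> by auto
  then obtain k :: nat where k: "k > 0" "jointly_ergodic (insert (?p \<otimes>\<^bsub>G\<^esub> \<alpha> (Suc n) [^]\<^bsub>G\<^esub> k) H)"
    using jointly_ergodic_combine[OF DCC _ a[of "Suc n"] Suc.prems(1) i(2)] by auto
  let ?i = "i(Suc n := k)"
  have "(\<Otimes>\<^bsub>G\<lparr>carrier := \<Gamma>\<rparr>\<^esub>j\<in>{1..Suc n}. \<alpha> j [^]\<^bsub>G\<^esub> ?i j)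
      = (\<Otimes>\<^bsub>G\<lparr>carrier := \<Gamma>\<rparr>\<^esub>j\<in>insert (Suc n) {1..n}. \<alpha> j [^]\<^bsub>G\<^esub> ?i j)"
    by (simp add: atLeastAtMostSuc_conv)
  also have "\<dots> = \<alpha> (Suc n) [^]\<^bsub>G\<^esub> k \<otimes>\<^bsub>G\<^esub> (\<Otimes>\<^bsub>G\<lparr>carrier := \<Gamma>\<rparr>\<^esub>j\<in>{1..n}. \<alpha> j [^]\<^bsub>G\<^esub> ?i j)"
    using a pow_\<Gamma> by (subst C.finprod_insert) (auto simp: Pi_iff)
  also have "(\<Otimes>\<^bsub>G\<lparr>carrier := \<Gamma>\<rparr>\<^esub>j\<in>{1..n}. \<alpha> j [^]\<^bsub>G\<^esub> ?i j) = ?p"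
    using a pow_\<Gamma> by (intro C.finprod_cong') (auto simp: Pi_iff)
  also have "\<alpha> (Suc n) [^]\<^bsub>G\<^esub> k \<otimes>\<^bsub>G\<^esub> ?p = ?p \<otimes>\<^bsub>G\<^esub> \<alpha> (Suc n) [^]\<^bsub>G\<^esub> k"
    using \<open>?p \<in> \<Gamma>\<close> pow_\<Gamma> a by (intro commute) auto
  finally show ?case
    using k i(1) by (intro exI[of _ ?i]) (auto simp: le_Suc_eq)
qed

end

theorem theorem4p1:
  fixes K :: "('a, 'b) monoid_scheme"
    and T :: "'a topology"
    and \<omega> :: "'a measure"
    and \<Gamma> :: "('a \<Rightarrow> 'a) set"
  assumes "compact_metrizable_group K T"
    and "normalized_haar_measure K T \<omega>"
    and "fin_gen_subgroup (Aut K T) \<Gamma>"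
    and "comm_group ((Aut K T)\<lparr>carrier := \<Gamma>\<rparr>)"
    and "ergodic T \<omega> \<Gamma>"
    and "DCC K T (centralizer (Aut K T) \<Gamma>)"
  shows "(\<exists>\<alpha> \<in> \<Gamma>. ergodic_automorphism K T \<omega> \<alpha>) \<and>
    (\<forall>(n :: nat) (\<alpha> :: nat \<Rightarrow> 'a \<Rightarrow> 'a).
       \<alpha> ` {1..n} \<subseteq> \<Gamma> \<and> generate (Aut K T) (\<alpha> ` {1..n}) = \<Gamma> \<longrightarrow>
       (\<exists>i :: nat \<Rightarrow> nat. (\<forall>j \<in> {1..n}. i j > 0) \<and>
          ergodic_automorphism K T \<omega>
            (\<Otimes>\<^bsub>(Aut K T)\<lparr>carrier := \<Gamma>\<rparr>\<^esub> j \<in> {1..n}. \<alpha> j [^]\<^bsub>Aut K T\<^esub> i j)))"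
proof -
  interpret C: comm_group "Aut K T\<lparr>carrier := \<Gamma>\<rparr>" by fact
  have "group K" using assms(1) by (simp add: compact_metrizable_group_def topological_group_def)
  then interpret abelian_action K T \<omega> \<Gamma>
    using assms(1-3) C.m_comm
    by (simp add: abelian_action_def abelian_action_axioms_def haar_group_def haar_group_axioms_def
        compact_group_def compact_group_axioms_def fin_gen_subgroup_def)
  \<comment> \<open>Membership in \<Gamma> is recorded too, because the first assertion is obtained
    by enumerating a finite generating set and applying this.\<close>
  have product: "\<exists>i :: nat \<Rightarrow> nat. (\<forall>j \<in> {1..n}. i j > 0) \<and>
      (\<Otimes>\<^bsub>(Aut K T)\<lparr>carrier := \<Gamma>\<rparr>\<^esub> j \<in> {1..n}. \<alpha> j [^]\<^bsub>Aut K T\<^esub> i j) \<in> \<Gamma> \<and>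
      ergodic_automorphism K T \<omega>
        (\<Otimes>\<^bsub>(Aut K T)\<lparr>carrier := \<Gamma>\<rparr>\<^esub> j \<in> {1..n}. \<alpha> j [^]\<^bsub>Aut K T\<^esub> i j)"
    if \<alpha>: "\<alpha> ` {1..n} \<subseteq> \<Gamma>" "generate (Aut K T) (\<alpha> ` {1..n}) = \<Gamma>"
    for n :: nat and \<alpha> :: "nat \<Rightarrow> 'a \<Rightarrow> 'a"
  proof -
    have "jointly_ergodic (\<alpha> ` {1..n} \<union> {})"
      using jointly_ergodic_generators[OF _ \<alpha> assms(5)] by simp
    from jointly_ergodic_product[OF assms(6,4) _ \<alpha>(1) this]
    obtain i :: "nat \<Rightarrow> nat" where i: "\<forall>j\<in>{1..n}. i j > 0"
      "jointly_ergodic {\<Otimes>\<^bsub>(Aut K T)\<lparr>carrier := \<Gamma>\<rparr>\<^esub> j \<in> {1..n}. \<alpha> j [^]\<^bsub>Aut K T\<^esub> i j}"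
      by auto
    have "(\<Otimes>\<^bsub>(Aut K T)\<lparr>carrier := \<Gamma>\<rparr>\<^esub> j \<in> {1..n}. \<alpha> j [^]\<^bsub>Aut K T\<^esub> i j) \<in> \<Gamma>"
      using C.finprod_closed[of "\<lambda>j. \<alpha> j [^]\<^bsub>Aut K T\<^esub> i j" "{1..n}"] \<alpha>(1) pow_\<Gamma> by auto
    with i jointly_ergodic_singleton show ?thesis by blast
  qed
  have "\<exists>\<alpha>\<in>\<Gamma>. ergodic_automorphism K T \<omega> \<alpha>"
  proof -
    obtain S where S: "finite S" "S \<subseteq> \<Gamma>" "generate (Aut K T) S = \<Gamma>"
      using assms(3) unfolding fin_gen_subgroup_def by blast
    obtain \<alpha> where "bij_betw \<alpha> {1..card S} S"
      using ex_bij_betw_nat_finite_1[OF S(1)] by blast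
    then have "\<alpha> ` {1..card S} = S" by (simp add: bij_betw_def)
    then show ?thesis using product[of \<alpha> "card S"] S(2,3) by metis
  qed
  then show ?thesis using product by blast
qed

end
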